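(* Let $(E,d)$ be a metric space with Borel $\sigma$-field $\mathcal{E}:=\mathcal{B}(E)$, let $P$ be a Markov kernel on $(E,\mathcal{E})$, and let $\mu_1$ and $\mu_2$ be invariant probability measures of $P$. (i) Assume that there exists a set $M\in\mathcal{E}\otimes\mathcal{E}$ such that $(\mu_1\otimes\mu_2)(M)>0$ and such that for every $(x,y)\in M$ there exists some $\alpha_{x,y}>0$ such that for every $\varepsilon>0$ there exists some $\xi^{\varepsilon}_{x,y}\in\hat{\mathcal{C}}(\mathbb{P}_x,\mathbb{P}_y)$ with $$\xi^{\varepsilon}_{x,y}\Big(\Big\{(\xi,\eta)\in E^{\mathbb{N}_0}\times E^{\mathbb{N}_0}:\ \limsup_{n\to\infty}\frac1n\sum_{i=0}^{n-1}\mathbf{1}_{[0,\varepsilon]}\big(d(\xi_i,\eta_i)\big)\ge\alpha_{x,y}\Big\}\Big)>0 .$$ Then $\mu_1$ and $\mu_2$ cannot be mutually singular. (ii) If, moreover, $E$ is Polish and $\rho:E\times E\to[0,\infty)$ is a lower semicontinuous and positive definite function such that the assumption in (i) holds with $d$ replaced by $\rho$ in the displayed inequality, then, again, $\mu_1$ and $\mu_2$ cannot be mutually singular.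
   Context: A Markov kernel $P$ on a measurable space $(E,\mathcal{E})$ is a map $P:E\times\mathcal{E}\to[0,1]$ such that $P(x,\cdot)$ is a probability measure for each $x$ and $P(\cdot,A)$ is measurable for each $A\in\mathcal{E}$. An invariant probability measure of $P$ is a probability measure $\pi$ on $(E,\mathcal{E})$ with $\pi P=\pi$, where $\pi P(A)=\int P(x,A)\,\mathrm{d}\pi(x)$. For $x\in E$, $\mathbb{P}_x$ denotes the law on $(E^{\mathbb{N}_0},\mathcal{E}^{\mathbb{N}_0})$ (product $\sigma$-field) of the Markov chain with kernel $P$ and initial condition $x$. $\hat{\mathcal{C}}(\mathbb{P}_x,\mathbb{P}_y)$ is the set of generalized couplings of $\mathbb{P}_x$ and $\mathbb{P}_y$: the set of all probability measures $\xi$ on $E^{\mathbb{N}_0}\times E^{\mathbb{N}_0}$ (with the product $\sigma$-field $\mathcal{E}^{\mathbb{N}_0}\otimes\mathcal{E}^{\mathbb{N}_0}$) such that $\pi_1(\xi)\ll\mathbb{P}_x$ and $\pi_2(\xi)\ll\mathbb{P}_y$, where $\pi_i(\xi)$ is the image of $\xi$ under the projection on the $i$-th coordinate ($i=1,2$) and $\ll$ denotes absolute continuity. Two probability measures $\mu,\nu$ on $(E,\mathcal{E})$ are mutually singular if there exists $C\in\mathcal{E}$ with $\mu(C)=1$ and $\nu(C)=0$. The metric space $E$ is not assumed separable. A metric space is called Polish here if its topology is separable and completely metrizable (the metric $d$ itself need not be complete). A function $\rho:E\times E\to[0,\infty)$ is positive definite if $\rho(x,y)=0$ if and only if $x=y$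 (neither symmetry nor a triangle inequality is required). Convention: if $E$ is not separable, $d$ need not be $\mathcal{B}(E)\otimes\mathcal{B}(E)$-measurable. Whenever a probability measure $\xi$ is evaluated at a set $A$ that is not measurable, $\xi(A)$ is interpreted as $\xi^*(A)$, where $\xi^*$ is the outer measure associated to $\xi$. *)

theory Defs
  imports "HOL-Probability.Probability"
begin

definition markov_kernel :: "'a measure \<Rightarrow> ('a \<Rightarrow> 'a measure) \<Rightarrow> bool" where
  "markov_kernel N P \<longleftrightarrow>
     (\<forall>x\<in>space N. prob_space (P x) \<and> sets (P x) = sets N) \<and>
     (\<forall>A\<in>sets N. (\<lambda>x. measure (P x) A) \<in> borel_measurable N)"

definition invariant_prob :: "'a measure \<Rightarrow> ('a \<Rightarrow> 'a measure) \<Rightarrow> 'a measure \<Rightarrow> bool" where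
  "invariant_prob N P \<pi> \<longleftrightarrow>
     prob_space \<pi> \<and> sets \<pi> = sets N \<and>
     (\<forall>A\<in>sets N. (\<integral>\<^sup>+x. emeasure (P x) A \<partial>\<pi>) = emeasure \<pi> A)"

abbreviation path_space :: "'a measure \<Rightarrow> (nat \<Rightarrow> 'a) measure" where
  "path_space N \<equiv> PiM UNIV (\<lambda>_. N)"

text \<open>Conditional law of the state at time \<open>n\<close> given the states at the times before \<open>n\<close>.\<close>

definition chain_step ::
    "'a measure \<Rightarrow> ('a \<Rightarrow> 'a measure) \<Rightarrow> 'a \<Rightarrow> nat \<Rightarrow> (nat \<Rightarrow> 'a) \<Rightarrow> 'a measure" where
  "chain_step N P x n \<omega> = (case n of 0 \<Rightarrow> return N x | Suc k \<Rightarrow> P (\<omega> k))"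

text \<open>The law of the chain started at \<open>x\<close> is the Ionescu-Tulcea measure of these
  conditional laws. For a Markov kernel, the lemmas \<open>sets_chain_law\<close>, \<open>prob_space_chain_law\<close>,
  \<open>chain_law_initial\<close> and \<open>chain_law_step\<close> below show that it is a probability measure on
  the path space with the prescribed initial state and transitions.\<close>

definition chain_law :: "'a measure \<Rightarrow> ('a \<Rightarrow> 'a measure) \<Rightarrow> 'a \<Rightarrow> (nat \<Rightarrow> 'a) measure" where
  "chain_law N P x =
     projective_family.lim UNIV (Ionescu_Tulcea.CI (chain_step N P x) (\<lambda>_. N)) (\<lambda>_. N)"

text \<open>The library's \<open>absolutely_continuous \<mu> \<nu>\<close> means that \<open>\<nu>\<close> is absolutely continuous
  with respect to \<open>\<mu>\<close>.\<close>

definition gen_couplings ::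
    "(nat \<Rightarrow> 'a) measure \<Rightarrow> (nat \<Rightarrow> 'a) measure \<Rightarrow> ((nat \<Rightarrow> 'a) \<times> (nat \<Rightarrow> 'a)) measure set" where
  "gen_couplings L1 L2 =
     {\<xi>. prob_space \<xi> \<and> sets \<xi> = sets (L1 \<Otimes>\<^sub>M L2) \<and>
         absolutely_continuous L1 (distr \<xi> L1 fst) \<and>
         absolutely_continuous L2 (distr \<xi> L2 snd)}"

definition mutually_singular :: "'a measure \<Rightarrow> 'a measure \<Rightarrow> bool" where
  "mutually_singular \<mu> \<nu> \<longleftrightarrow> (\<exists>C\<in>sets \<mu>. emeasure \<mu> C = 1 \<and> emeasure \<nu> C = 0)"

definition lower_semicontinuous :: "('a::topological_space \<Rightarrow> real) \<Rightarrow> bool" where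
  "lower_semicontinuous f \<longleftrightarrow> (\<forall>z c. c < f z \<longrightarrow> (\<forall>\<^sub>F w in nhds z. c < f w))"

text \<open>The limsup is taken in the extended reals.\<close>

definition frequently_close ::
    "('a \<Rightarrow> 'a \<Rightarrow> real) \<Rightarrow> real \<Rightarrow> real \<Rightarrow> ((nat \<Rightarrow> 'a) \<times> (nat \<Rightarrow> 'a)) set" where
  "frequently_close \<delta> \<epsilon> \<alpha> =
     {(\<xi>, \<eta>). limsup (\<lambda>n. ereal (1 / real n * (\<Sum>i<n. indicator {0..\<epsilon>} (\<delta> (\<xi> i) (\<eta> i)))))
               \<ge> ereal \<alpha>}"

text \<open>The outer measure is needed as \<open>dist\<close> need not be measurable for the product
  sigma-algebra if the space is not separable; on measurable sets it agrees with
  \<open>emeasure\<close>. For the same reason \<open>borel \<Otimes>\<^sub>M borel\<close> is not replaced by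
  the Borel sigma-algebra of the product topology.\<close>

definition coupling_condition ::
    "('a::topological_space \<Rightarrow> 'a \<Rightarrow> real) \<Rightarrow> ('a \<Rightarrow> 'a measure) \<Rightarrow> 'a measure \<Rightarrow> 'a measure \<Rightarrow> bool" where
  "coupling_condition \<delta> P \<mu>1 \<mu>2 \<longleftrightarrow>
     (\<exists>M\<in>sets (borel \<Otimes>\<^sub>M borel). emeasure (\<mu>1 \<Otimes>\<^sub>M \<mu>2) M > 0 \<and>
        (\<forall>(x, y)\<in>M. \<exists>\<alpha>>0. \<forall>\<epsilon>>0.
           \<exists>\<xi>\<in>gen_couplings (chain_law borel P x) (chain_law borel P y).
             outer_measure_of \<xi> (frequently_close \<delta> \<epsilon> \<alpha>) > 0))"


lemma markov_kernel_measurable: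
  assumes "markov_kernel N P"
  shows "P \<in> measurable N (subprob_algebra N)"
proof (rule measurable_subprob_algebra)
  fix A assume A: "A \<in> sets N"
  have "emeasure (P x) A = ennreal (measure (P x) A)" if "x \<in> space N" for x
  proof -
    interpret prob_space "P x" using assms that by (simp add: markov_kernel_def)
    show ?thesis by (rule emeasure_eq_measure)
  qed
  moreover have "(\<lambda>x. ennreal (measure (P x) A)) \<in> borel_measurable N"
    using assms A by (simp add: markov_kernel_def)
  ultimately show "(\<lambda>x. emeasure (P x) A) \<in> borel_measurable N"
    by (simp cong: measurable_cong)
qed (use assms in \<open>auto simp: markov_kernel_def prob_space_imp_subprob_space\<close>)

lemma chain_step_Ionescu_Tulcea:
  fixes N :: "'a measure"
  assumes ker: "markov_kernel N P" and x: "x \<in> space N"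
  shows "Ionescu_Tulcea (chain_step N P x) (\<lambda>_. N)"
proof (rule Ionescu_Tulcea.intro)
  note [measurable] = markov_kernel_measurable[OF ker]
  fix i
  show "chain_step N P x i \<in> measurable (PiM {0..<i} (\<lambda>_. N)) (subprob_algebra N)"
  proof (cases i)
    case 0
    have "(\<lambda>\<omega>. return N x) \<in> measurable (PiM {0..<i} (\<lambda>_. N)) (subprob_algebra N)"
      using x by (auto simp: space_subprob_algebra intro!: subprob_space_return)
    then show ?thesis by (simp add: 0 chain_step_def[abs_def])
  next
    case (Suc k)
    have "(\<lambda>\<omega>. P (\<omega> k)) \<in> measurable (PiM {0..<i} (\<lambda>_. N)) (subprob_algebra N)"
      by (rule measurable_compose[OF measurable_component_singleton])
         (auto simp: Suc markov_kernel_measurable[OF ker])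
    then show ?thesis by (simp add: Suc chain_step_def[abs_def])
  qed
next
  fix i and \<omega> :: "nat \<Rightarrow> 'a" assume "\<omega> \<in> space (PiM {0..<i} (\<lambda>_. N))"
  then show "prob_space (chain_step N P x i \<omega>)"
    using ker x by (auto simp: chain_step_def markov_kernel_def space_PiM PiE_iff
                   intro!: prob_space_return split: nat.split)
qed

lemma sets_chain_law:
  assumes "markov_kernel N P" "x \<in> space N"
  shows "sets (chain_law N P x) = sets (path_space N)"
proof -
  interpret Ionescu_Tulcea "chain_step N P x" "\<lambda>_. N"
    by (rule chain_step_Ionescu_Tulcea[OF assms])
  show ?thesis unfolding chain_law_def by simp
qed

lemma emeasure_chain_law:
  assumes "markov_kernel N P" "x \<in> space N" "X \<in> sets (PiM {0..<n} (\<lambda>_. N))"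
  shows "emeasure (chain_law N P x) (prod_emb UNIV (\<lambda>_. N) {0..<n} X) =
           emeasure (Ionescu_Tulcea.C (chain_step N P x) (\<lambda>_. N) 0 n (\<lambda>_. undefined)) X"
proof -
  interpret Ionescu_Tulcea "chain_step N P x" "\<lambda>_. N"
    by (rule chain_step_Ionescu_Tulcea[OF assms(1,2)])
  have "PF.emb {0..<n} {0..<n} X = X"
    using assms(3) sets.sets_into_space[OF assms(3)] by (intro prod_emb_id) (auto simp: space_PiM)
  then show ?thesis
    unfolding chain_law_def using lim[of "{0..<n}" X] emeasure_CI[of "{0..<n}" n X] assms(3) by simp
qed

lemma prob_space_chain_law:
  assumes "markov_kernel N P" "x \<in> space N"
  shows "prob_space (chain_law N P x)"
proof -
  interpret Ionescu_Tulcea "chain_step N P x" "\<lambda>_. N"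
    by (rule chain_step_Ionescu_Tulcea[OF assms])
  interpret C: prob_space "C 0 0 (\<lambda>_. undefined)" by (rule prob_space_C) simp
  have s: "space (chain_law N P x) = space (path_space N)"
    by (rule sets_eq_imp_space_eq[OF sets_chain_law[OF assms]])
  have "prod_emb UNIV (\<lambda>_. N) {0..<0} (space (PiM {0..<0} (\<lambda>_. N))) = space (path_space N)"
    by (auto simp: prod_emb_def space_PiM PiE_iff)
  moreover have "space (C 0 0 (\<lambda>_. undefined)) = space (PiM {0..<0} (\<lambda>_. N))"
    using space_C[of "\<lambda>_. undefined" 0 0] by simp
  ultimately have "emeasure (chain_law N P x) (space (path_space N)) = 1"
    using emeasure_chain_law[OF assms sets.top, of 0] C.emeasure_space_1 by simp
  with s show ?thesis by (intro prob_spaceI) simp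
qed

lemma distr_chain_law:
  assumes "markov_kernel N P" "x \<in> space N"
  shows "distr (chain_law N P x) (PiM {0..<n} (\<lambda>_. N)) (\<lambda>\<omega>. restrict \<omega> {0..<n}) =
           Ionescu_Tulcea.C (chain_step N P x) (\<lambda>_. N) 0 n (\<lambda>_. undefined)"
proof (rule measure_eqI)
  interpret Ionescu_Tulcea "chain_step N P x" "\<lambda>_. N"
    by (rule chain_step_Ionescu_Tulcea[OF assms])
  show *: "sets (distr (chain_law N P x) (PiM {0..<n} (\<lambda>_. N)) (\<lambda>\<omega>. restrict \<omega> {0..<n})) =
        sets (C 0 n (\<lambda>_. undefined))"
    using sets_C[of "\<lambda>_. undefined" 0 n] by simp
  fix X assume "X \<in> sets (distr (chain_law N P x) (PiM {0..<n} (\<lambda>_. N)) (\<lambda>\<omega>. restrict \<omega> {0..<n}))"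
  then have X: "X \<in> sets (PiM {0..<n} (\<lambda>_. N))" by simp
  show "emeasure (distr (chain_law N P x) (PiM {0..<n} (\<lambda>_. N)) (\<lambda>\<omega>. restrict \<omega> {0..<n})) X =
        emeasure (C 0 n (\<lambda>_. undefined)) X"
    using emeasure_chain_law[OF assms X]
    using emeasure_distr_restrict[OF subset_UNIV sets_chain_law[OF assms] X] by simp
qed

lemma chain_law_initial:
  assumes ker: "markov_kernel N P" and x: "x \<in> space N" and A: "A \<in> sets N"
  shows "emeasure (chain_law N P x) {\<omega>\<in>space (path_space N). \<omega> 0 \<in> A} = indicator A x"
proof -
  interpret Ionescu_Tulcea "chain_step N P x" "\<lambda>_. N"
    by (rule chain_step_Ionescu_Tulcea[OF ker x])
  let ?X = "{\<omega>\<in>space (PiM {0..<Suc 0} (\<lambda>_. N)). \<omega> 0 \<in> A}"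
  note [measurable] = A
  have [measurable]: "(\<lambda>\<omega>. \<omega> 0) \<in> measurable (PiM {0..<Suc 0} (\<lambda>_. N)) N"
    by (rule measurable_component_singleton) simp
  have X[measurable]: "?X \<in> sets (PiM {0..<Suc 0} (\<lambda>_. N))" by measurable
  have "prod_emb UNIV (\<lambda>_. N) {0..<Suc 0} ?X = {\<omega>\<in>space (path_space N). \<omega> 0 \<in> A}"
    by (auto simp: prod_emb_def space_PiM PiE_iff extensional_def)
  moreover have "C 0 (Suc 0) (\<lambda>_. undefined) = eP 0 (\<lambda>_. undefined)"
  proof -
    have "C 0 (Suc 0) (\<lambda>_. undefined) = return (PiM {0..<0} (\<lambda>_. N)) (\<lambda>_. undefined) \<bind> eP 0" by simp
    also have "\<dots> = eP 0 (\<lambda>_. undefined)"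
      by (rule bind_return[OF measurable_eP]) (simp add: space_PiM)
    finally show ?thesis .
  qed
  moreover have "emeasure (eP 0 (\<lambda>_. undefined)) ?X = indicator A x"
  proof -
    have "(\<lambda>y. (\<lambda>_. undefined)(0 := y)) -` ?X \<inter> space N = A"
      using sets.sets_into_space[OF A] by (auto simp: space_PiM PiE_iff extensional_def)
    then show ?thesis
      using X A by (subst emeasure_eP) (auto simp: space_PiM chain_step_def)
  qed
  ultimately show ?thesis using emeasure_chain_law[OF ker x X] by simp
qed

lemma chain_law_step:
  assumes ker: "markov_kernel N P" and x: "x \<in> space N"
    and B: "B \<in> sets (PiM {0..<Suc n} (\<lambda>_. N))" and A: "A \<in> sets N"
  shows "emeasure (chain_law N P x)
           {\<omega>\<in>space (path_space N). restrict \<omega> {0..<Suc n} \<in> B \<and> \<omega> (Suc n) \<in> A} =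
         (\<integral>\<^sup>+\<omega>. indicator B (restrict \<omega> {0..<Suc n}) * emeasure (P (\<omega> n)) A \<partial>chain_law N P x)"
proof -
  interpret Ionescu_Tulcea "chain_step N P x" "\<lambda>_. N"
    by (rule chain_step_Ionescu_Tulcea[OF ker x])
  let ?m = "Suc n" and ?u = "\<lambda>_. undefined"
  note [measurable] = A B markov_kernel_measurable[OF ker] 
  have r[measurable]: "(\<lambda>\<omega>. restrict \<omega> {0..<?m}) \<in> measurable (PiM {0..<Suc ?m} (\<lambda>_. N)) (PiM {0..<?m} (\<lambda>_. N))"
    by (rule measurable_restrict_subset) auto
  have r'[measurable]: "(\<lambda>\<omega>. restrict \<omega> {0..<?m}) \<in> measurable (chain_law N P x) (PiM {0..<?m} (\<lambda>_. N))"
    unfolding measurable_cong_sets[OF sets_chain_law[OF ker x] refl]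
    by (rule measurable_restrict_subset) auto
  let ?X = "{\<omega>\<in>space (PiM {0..<Suc ?m} (\<lambda>_. N)). restrict \<omega> {0..<?m} \<in> B \<and> \<omega> ?m \<in> A}"
  have X[measurable]: "?X \<in> sets (PiM {0..<Suc ?m} (\<lambda>_. N))" by measurable
  have "prod_emb UNIV (\<lambda>_. N) {0..<Suc ?m} ?X =
      {\<omega>\<in>space (path_space N). restrict \<omega> {0..<?m} \<in> B \<and> \<omega> ?m \<in> A}"
    by (auto simp: prod_emb_def space_PiM PiE_iff extensional_def restrict_def cong: if_cong)
  then have "emeasure (chain_law N P x) {\<omega>\<in>space (path_space N). restrict \<omega> {0..<?m} \<in> B \<and> \<omega> ?m \<in> A}
      = emeasure (C 0 (Suc ?m) ?u) ?X"
    using emeasure_chain_law[OF ker x X] by simp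
  also have "C 0 (Suc ?m) ?u = C 0 ?m ?u \<bind> eP ?m" by simp
  also have "emeasure \<dots> ?X = (\<integral>\<^sup>+\<omega>. emeasure (eP ?m \<omega>) ?X \<partial>C 0 ?m ?u)"
  proof (rule emeasure_bind[OF _ _ X])
    show "space (C 0 ?m ?u) \<noteq> {}"
      by (rule prob_space.not_empty[OF prob_space_C]) simp
    show "eP ?m \<in> measurable (C 0 ?m ?u) (subprob_algebra (PiM {0..<Suc ?m} (\<lambda>_. N)))"
      using measurable_eP[of ?m] sets_C[of ?u 0 ?m] by (simp cong: measurable_cong_sets)
  qed
  also have "\<dots> = (\<integral>\<^sup>+\<omega>. indicator B \<omega> * emeasure (P (\<omega> n)) A \<partial>C 0 ?m ?u)"
  proof (rule nn_integral_cong)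
    fix \<omega> assume "\<omega> \<in> space (C 0 ?m ?u)"
    then have \<omega>: "\<omega> \<in> space (PiM {0..<?m} (\<lambda>_. N))" using space_C[of ?u 0 ?m] by simp
    have eq: "restrict (fun_upd \<omega> ?m y) {0..<?m} = \<omega>" for y
      using \<omega> by (auto simp: space_PiM PiE_iff extensional_def fun_eq_iff)
    have "(\<lambda>y. fun_upd \<omega> ?m y) -` ?X \<inter> space N = (if \<omega> \<in> B then A else {})"
      using sets.sets_into_space[OF A] \<omega> unfolding vimage_def
      by (auto simp: eq) (auto simp: space_PiM PiE_iff extensional_def)
    then show "emeasure (eP ?m \<omega>) ?X = indicator B \<omega> * emeasure (P (\<omega> n)) A"
      using \<omega> X by (simp add: emeasure_eP chain_step_def)
  qed
  also have "\<dots> = (\<integral>\<^sup>+\<omega>. indicator B (restrict \<omega> {0..<?m}) * emeasure (P (restrict \<omega> {0..<?m} n)) A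
      \<partial>chain_law N P x)"
    unfolding distr_chain_law[OF ker x, symmetric] 
    by (subst nn_integral_distr) (simp_all)
  also have "\<dots> = (\<integral>\<^sup>+\<omega>. indicator B (restrict \<omega> {0..<?m}) * emeasure (P (\<omega> n)) A \<partial>chain_law N P x)"
    by simp
  finally show ?thesis .
qed

end

theory Submission
  imports Defs
begin

text \<open>If \<open>\<mu>1\<close> and \<open>\<mu>2\<close> are mutually singular, there are sets \<open>F1\<close>, \<open>F2\<close> whose complements
  have \<open>\<mu>1\<close>- respectively \<open>\<mu>2\<close>-measure at most \<open>2 ^ -k\<close> and on whose product \<open>\<delta>\<close> is bounded
  below by some \<open>\<eta> > 0\<close>. For part (i) they come from closed regularity, for part (ii) from
  tightness and lower semicontinuity. By the maximal ergodic inequality, a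
  stationary path spends an upper fraction of time at least \<open>c\<close> outside \<open>F1\<close> with probability at
  most \<open>2 / (c 2 ^ k)\<close>. This event is shift-invariant, so from almost every starting point its
  probability is 0 or 1. By the Borel-Cantelli lemma, from almost every starting point it is 0 for
  all large \<open>k\<close>, and this null event stays null under a generalized coupling. For
  \<open>\<epsilon> < \<eta>\<close> the paths are \<open>\<epsilon>\<close>-close only when one of them is outside its set \<open>Fi\<close>, hence with
  upper frequency below any given \<open>\<alpha>\<close>.\<close>

section \<open>The Markov property\<close>

text \<open>Absolute continuity preserves null events but no bound on probabilities: an event of
  tiny probability under \<open>chain_law N P x\<close> may have probability 1 under a marginal of a
  generalized coupling. So an estimate of the time spent outside \<open>F1\<close>, however small,
  says nothing about the coupling until the zero-one law has turned it into a statement about null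
  events. The measures may fail to be ergodic, so the value 0 or 1 can depend on the starting point;
  this is why it is the bad starting points to which Borel-Cantelli is applied. The threshold
  \<alpha> is known only after (x, y) has been chosen, and it does not depend on \<epsilon>. Hence
  the order of choices: a good starting point works for every level c at once, k is then taken from
  \<alpha>, and only then \<epsilon> from k. On a non-separable space the set of pairs with dist a b
  \<le> \<epsilon> may be non-measurable. The events that are estimated therefore concern a single
  path and a single Borel set, and the pair of paths enters only through a cover by a null
  set.\<close>

lemma measurable_restrict_path[measurable]:
  "(\<lambda>\<omega>. restrict \<omega> {0..<m}) \<in> measurable (path_space N) (PiM {0..<m} (\<lambda>_. N))"
  by (rule measurable_restrict_subset) auto

text \<open>Coordinates outside J are constrained by \<open>space N\<close> only, so that every
  finite index set becomes an initial segment \<open>{..m}\<close>, the shape on which a recursion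
  over time works.\<close>

lemma prod_emb_path_rectangle:
  assumes "finite J" and A: "\<And>i. i \<in> J \<Longrightarrow> A i \<in> sets N"
  shows "\<exists>A' m. (\<forall>i. A' i \<in> sets N) \<and>
    prod_emb UNIV (\<lambda>_. N) J (Pi\<^sub>E J A) = {\<omega>\<in>space (path_space N). \<forall>i\<le>m::nat. \<omega> i \<in> A' i}"
proof -
  obtain m where m: "J \<subseteq> {..m}" using \<open>finite J\<close> finite_nat_iff_bounded_le by blast
  let ?A = "\<lambda>i. if i \<in> J then A i else space N"
  have "prod_emb UNIV (\<lambda>_. N) J (Pi\<^sub>E J A) = {\<omega>\<in>space (path_space N). \<forall>i\<le>m. \<omega> i \<in> ?A i}"
    using subsetD[OF m] by (auto simp: prod_emb_def space_PiM PiE_iff extensional_def)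
  moreover have "\<forall>i. ?A i \<in> sets N" using A by simp
  ultimately show ?thesis by (intro exI[of _ ?A] exI[of _ m] conjI)
qed

lemma prod_algebra_path_rectangle:
  assumes "R \<in> prod_algebra UNIV (\<lambda>_. N)"
  shows "\<exists>A m. (\<forall>i. A i \<in> sets N) \<and> R = {\<omega>\<in>space (path_space N). \<forall>i\<le>m::nat. \<omega> i \<in> A i}"
  using assms
proof (rule prod_algebraE)
  fix J E assume R: "R = prod_emb UNIV (\<lambda>_. N) J (Pi\<^sub>E J E)" "finite J" "\<And>i. i \<in> J \<Longrightarrow> E i \<in> sets N"
  show ?thesis
    unfolding R(1) by (rule prod_emb_path_rectangle[OF R(2,3)])
qed

text \<open>\<open>chain_law_step\<close> is the case of an indicator. Both sides are additive,
  homogeneous and continuous along increasing sequences in f, and induction over nonnegative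
  measurable functions gives the rest.\<close>

lemma nn_integral_chain_law_step:
  assumes ker: "markov_kernel N P" and x: "x \<in> space N"
    and B: "B \<in> sets (PiM {0..<Suc n} (\<lambda>_. N))" and f: "f \<in> borel_measurable N"
  shows "(\<integral>\<^sup>+\<omega>. indicator B (restrict \<omega> {0..<Suc n}) * f (\<omega> (Suc n)) \<partial>chain_law N P x) =
         (\<integral>\<^sup>+\<omega>. indicator B (restrict \<omega> {0..<Suc n}) * (\<integral>\<^sup>+y. f y \<partial>P (\<omega> n)) \<partial>chain_law N P x)"
proof -
  have [measurable_cong]: "sets (chain_law N P x) = sets (path_space N)"
    by (rule sets_chain_law[OF ker x])
  note [measurable] = markov_kernel_measurable[OF ker] B
  have sp: "\<omega> i \<in> space N" if "\<omega> \<in> space (chain_law N P x)" for \<omega> i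
    using that sets_eq_imp_space_eq[OF sets_chain_law[OF ker x]] by (auto simp: space_PiM)
  have sP: "sets (P (\<omega> i)) = sets N" if "\<omega> \<in> space (chain_law N P x)" for \<omega> i
    using sp[OF that] ker by (auto simp: markov_kernel_def)
  let ?L = "chain_law N P x" and ?B = "\<lambda>\<omega>. indicator B (restrict \<omega> {0..<Suc n}) :: ennreal"
  show ?thesis
    using f
  proof induction
    case (cong f g)
    have "(\<integral>\<^sup>+\<omega>. ?B \<omega> * f (\<omega> (Suc n)) \<partial>?L) = (\<integral>\<^sup>+\<omega>. ?B \<omega> * g (\<omega> (Suc n)) \<partial>?L)"
      by (intro nn_integral_cong) (simp add: cong sp)
    moreover have "(\<integral>\<^sup>+\<omega>. ?B \<omega> * (\<integral>\<^sup>+y. f y \<partial>P (\<omega> n)) \<partial>?L) = (\<integral>\<^sup>+\<omega>. ?B \<omega> * (\<integral>\<^sup>+y. g y \<partial>P (\<omega> n)) \<partial>?L)"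
      by (intro nn_integral_cong arg_cong2[where f="(*)"] refl cong)
        (simp add: sets_eq_imp_space_eq[OF sP])
    ultimately show ?case using cong(4) by (simp only:)
  next
    case (set A)
    have "(\<integral>\<^sup>+\<omega>. ?B \<omega> * indicator A (\<omega> (Suc n)) \<partial>?L) =
        (\<integral>\<^sup>+\<omega>. indicator {\<omega>\<in>space (path_space N). restrict \<omega> {0..<Suc n} \<in> B \<and> \<omega> (Suc n) \<in> A} \<omega> \<partial>?L)"
      using sets_eq_imp_space_eq[OF sets_chain_law[OF ker x]]
      by (intro nn_integral_cong) (auto simp: indicator_def)
    also have "\<dots> = emeasure ?L {\<omega>\<in>space (path_space N). restrict \<omega> {0..<Suc n} \<in> B \<and> \<omega> (Suc n) \<in> A}"
      using set by (intro nn_integral_indicator) simp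
    also have "\<dots> = (\<integral>\<^sup>+\<omega>. ?B \<omega> * emeasure (P (\<omega> n)) A \<partial>?L)"
      by (rule chain_law_step[OF ker x B set])
    also have "\<dots> = (\<integral>\<^sup>+\<omega>. ?B \<omega> * (\<integral>\<^sup>+y. indicator A y \<partial>P (\<omega> n)) \<partial>?L)"
      using set by (intro nn_integral_cong) (simp add: sP)
    finally show ?case .
  next
    case (mult u c)
    note [measurable] = mult(2)
    have "(\<integral>\<^sup>+\<omega>. ?B \<omega> * (c * u (\<omega> (Suc n))) \<partial>?L) = c * (\<integral>\<^sup>+\<omega>. ?B \<omega> * u (\<omega> (Suc n)) \<partial>?L)"
      by (subst nn_integral_cmult[symmetric]) (simp_all add: mult_ac)
    also have "\<dots> = (\<integral>\<^sup>+\<omega>. ?B \<omega> * (c * (\<integral>\<^sup>+y. u y \<partial>P (\<omega> n))) \<partial>?L)"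
      unfolding mult by (subst nn_integral_cmult[symmetric]) (simp_all add: mult_ac)
    also have "\<dots> = (\<integral>\<^sup>+\<omega>. ?B \<omega> * (\<integral>\<^sup>+y. c * u y \<partial>P (\<omega> n)) \<partial>?L)"
      by (intro nn_integral_cong)
        (simp add: nn_integral_cmult measurable_cong_sets[OF sP refl])
    finally show ?case .
  next
    case (add u v)
    note [measurable] = add(1,3)
    have "(\<integral>\<^sup>+\<omega>. ?B \<omega> * (u (\<omega> (Suc n)) + v (\<omega> (Suc n))) \<partial>?L) =
        (\<integral>\<^sup>+\<omega>. ?B \<omega> * u (\<omega> (Suc n)) \<partial>?L) + (\<integral>\<^sup>+\<omega>. ?B \<omega> * v (\<omega> (Suc n)) \<partial>?L)"
      by (subst nn_integral_add[symmetric]) (simp_all add: distrib_left)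
    also have "\<dots> = (\<integral>\<^sup>+\<omega>. ?B \<omega> * ((\<integral>\<^sup>+y. u y \<partial>P (\<omega> n)) + (\<integral>\<^sup>+y. v y \<partial>P (\<omega> n))) \<partial>?L)"
      unfolding add by (subst nn_integral_add[symmetric]) (simp_all add: distrib_left)
    also have "\<dots> = (\<integral>\<^sup>+\<omega>. ?B \<omega> * (\<integral>\<^sup>+y. u y + v y \<partial>P (\<omega> n)) \<partial>?L)"
      by (intro nn_integral_cong)
        (simp add: nn_integral_add measurable_cong_sets[OF sP refl])
    finally show ?case by (simp only: add.commute)
  next
    case (seq U)
    note [measurable] = seq(1)
    have mono: "mono (\<lambda>i. \<integral>\<^sup>+y. U i y \<partial>P z)" for z
      using \<open>incseq U\<close> by (auto intro!: monoI nn_integral_mono simp: incseq_def le_fun_def)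
    have "(\<integral>\<^sup>+\<omega>. ?B \<omega> * (SUP i. U i) (\<omega> (Suc n)) \<partial>?L) = (\<integral>\<^sup>+\<omega>. (SUP i. ?B \<omega> * U i (\<omega> (Suc n))) \<partial>?L)"
      by (intro nn_integral_cong) (simp add: SUP_mult_left_ennreal image_comp)
    also have "\<dots> = (SUP i. \<integral>\<^sup>+\<omega>. ?B \<omega> * U i (\<omega> (Suc n)) \<partial>?L)"
      using \<open>incseq U\<close>
      by (intro nn_integral_monotone_convergence_SUP) (auto simp: incseq_def le_fun_def intro!: mult_left_mono)
    also have "\<dots> = (SUP i. \<integral>\<^sup>+\<omega>. ?B \<omega> * (\<integral>\<^sup>+y. U i y \<partial>P (\<omega> n)) \<partial>?L)"
      by (simp only: seq)
    also have "\<dots> = (\<integral>\<^sup>+\<omega>. (SUP i. ?B \<omega> * (\<integral>\<^sup>+y. U i y \<partial>P (\<omega> n))) \<partial>?L)"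
      using mono by (intro nn_integral_monotone_convergence_SUP[symmetric])
         (auto simp: incseq_def le_fun_def intro!: mult_left_mono)
    also have "\<dots> = (\<integral>\<^sup>+\<omega>. ?B \<omega> * (\<integral>\<^sup>+y. (SUP i. U i) y \<partial>P (\<omega> n)) \<partial>?L)"
    proof (intro nn_integral_cong)
      fix \<omega> assume \<omega>: "\<omega> \<in> space ?L"
      have "(\<integral>\<^sup>+y. (SUP i. U i) y \<partial>P (\<omega> n)) = (SUP i. \<integral>\<^sup>+y. U i y \<partial>P (\<omega> n))"
        unfolding SUP_apply using \<open>incseq U\<close>
        by (intro nn_integral_monotone_convergence_SUP) (simp_all add: measurable_cong_sets[OF sP[OF \<omega>] refl])
      then show "(SUP i. ?B \<omega> * (\<integral>\<^sup>+y. U i y \<partial>P (\<omega> n))) = ?B \<omega> * (\<integral>\<^sup>+y. (SUP i. U i) y \<partial>P (\<omega> n))"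
        by (simp add: SUP_mult_left_ennreal)
    qed
    finally show ?case .
  qed
qed

text \<open>For the chain started at \<open>x\<close>, this is the expectation of
  \<open>f (\<omega> m)\<close> on the event \<open>\<forall>i\<le>m. \<omega> i \<in> A i\<close>.\<close>

primrec rectangle_op ::
    "('a \<Rightarrow> 'a measure) \<Rightarrow> (nat \<Rightarrow> 'a set) \<Rightarrow> nat \<Rightarrow> ('a \<Rightarrow> ennreal) \<Rightarrow> 'a \<Rightarrow> ennreal" where
  "rectangle_op P A 0 f = (\<lambda>x. indicator (A 0) x * f x)"
| "rectangle_op P A (Suc m) f =
     rectangle_op P A m (\<lambda>z. \<integral>\<^sup>+y. indicator (A (Suc m)) y * f y \<partial>P z)"

lemma measurable_rectangle_op[measurable]:
  assumes ker: "markov_kernel N P" and [measurable]: "\<And>i. A i \<in> sets N" "f \<in> borel_measurable N"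
  shows "rectangle_op P A m f \<in> borel_measurable N"
  using assms(3)
proof (induction m arbitrary: f)
  case (Suc m)
  note [measurable] = markov_kernel_measurable[OF ker] Suc.prems
  show ?case by (simp, intro Suc.IH) measurable
qed simp

text \<open>The last time is peeled off first: B and the constraints up to time n + m form one event
  \<open>?X\<close> of the first n + m + 1 states, the one-step formula integrates out the next
  state, and what remains is the claim for m with a new integrand. Hence f is arbitrary in the
  induction.\<close>

lemma nn_integral_chain_law_rectangle:
  assumes ker: "markov_kernel N P" and x: "x \<in> space N"
    and B: "B \<in> sets (PiM {0..<Suc n} (\<lambda>_. N))" and A: "\<And>i. A i \<in> sets N"
    and f: "f \<in> borel_measurable N"
  shows "(\<integral>\<^sup>+\<omega>. indicator B (restrict \<omega> {0..<Suc n}) * (indicator {\<omega>. \<forall>i\<le>m. \<omega> (n + i) \<in> A i} \<omega> * f (\<omega> (n + m)))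
             \<partial>chain_law N P x) =
         (\<integral>\<^sup>+\<omega>. indicator B (restrict \<omega> {0..<Suc n}) * rectangle_op P A m f (\<omega> n) \<partial>chain_law N P x)"
  using f
proof (induction m arbitrary: f)
  case 0
  show ?case by (intro nn_integral_cong) (simp add: indicator_def)
next
  case (Suc m)
  note [measurable] = markov_kernel_measurable[OF ker] Suc.prems A B
  have sp: "space (chain_law N P x) = space (path_space N)"
    by (rule sets_eq_imp_space_eq[OF sets_chain_law[OF ker x]])
  let ?L = "chain_law N P x"
  let ?g = "\<lambda>y. indicator (A (Suc m)) y * f y"
  let ?X = "{\<omega>\<in>space (PiM {0..<Suc (n + m)} (\<lambda>_. N)). restrict \<omega> {0..<Suc n} \<in> B \<and> (\<forall>i\<le>m. \<omega> (n + i) \<in> A i)}"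
  have [measurable]: "(\<lambda>\<omega>. restrict \<omega> {0..<Suc n}) \<in> measurable (PiM {0..<Suc (n + m)} (\<lambda>_. N)) (PiM {0..<Suc n} (\<lambda>_. N))"
    by (rule measurable_restrict_subset) auto
  have [measurable]: "(\<lambda>\<omega>. \<omega> (n + i)) \<in> measurable (PiM {0..<Suc (n + m)} (\<lambda>_. N)) N" if "i \<le> m" for i
    by (rule measurable_component_singleton) (use that in auto)
  have "?X = {\<omega>\<in>space (PiM {0..<Suc (n + m)} (\<lambda>_. N)). restrict \<omega> {0..<Suc n} \<in> B} \<inter>
     {\<omega>\<in>space (PiM {0..<Suc (n + m)} (\<lambda>_. N)). \<forall>i\<in>{..m}. \<omega> (n + i) \<in> A i}" by auto
  also have "\<dots> \<in> sets (PiM {0..<Suc (n + m)} (\<lambda>_. N))"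
    by (intro sets.Int sets.sets_Collect_finite_All') (auto intro!: measurable_sets_Collect[of _ _ N])
  finally have X: "?X \<in> sets (PiM {0..<Suc (n + m)} (\<lambda>_. N))" .
  have eq: "indicator ?X (restrict \<omega> {0..<Suc (n + m)}) =
      (indicator B (restrict \<omega> {0..<Suc n}) * indicator {\<omega>. \<forall>i\<le>m. \<omega> (n + i) \<in> A i} \<omega> :: ennreal)"
    if "\<omega> \<in> space ?L" for \<omega>
  proof -
    have "restrict \<omega> {0..<Suc (n + m)} \<in> space (PiM {0..<Suc (n + m)} (\<lambda>_. N))"
      using that by (auto simp: sp space_PiM)
    moreover have "restrict (restrict \<omega> {0..<Suc (n + m)}) {0..<Suc n} = restrict \<omega> {0..<Suc n}"
      by (auto simp: restrict_def)
    ultimately show ?thesis by (auto simp: indicator_def less_Suc_eq_le)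
  qed
  have "(\<integral>\<^sup>+\<omega>. indicator B (restrict \<omega> {0..<Suc n}) *
        (indicator {\<omega>. \<forall>i\<le>Suc m. \<omega> (n + i) \<in> A i} \<omega> * f (\<omega> (n + Suc m))) \<partial>?L) =
     (\<integral>\<^sup>+\<omega>. indicator ?X (restrict \<omega> {0..<Suc (n + m)}) * ?g (\<omega> (Suc (n + m))) \<partial>?L)"
  proof (intro nn_integral_cong)
    fix \<omega> assume "\<omega> \<in> space ?L"
    moreover have "indicator {\<omega>. \<forall>i\<le>Suc m. \<omega> (n + i) \<in> A i} \<omega> =
        (indicator {\<omega>. \<forall>i\<le>m. \<omega> (n + i) \<in> A i} \<omega> * indicator (A (Suc m)) (\<omega> (Suc (n + m))) :: ennreal)"
      by (auto simp: indicator_def le_Suc_eq)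
    ultimately show "indicator B (restrict \<omega> {0..<Suc n}) *
        (indicator {\<omega>. \<forall>i\<le>Suc m. \<omega> (n + i) \<in> A i} \<omega> * f (\<omega> (n + Suc m))) =
      indicator ?X (restrict \<omega> {0..<Suc (n + m)}) * ?g (\<omega> (Suc (n + m)))"
      by (simp only: eq mult.assoc add_Suc_right)
  qed
  also have "\<dots> = (\<integral>\<^sup>+\<omega>. indicator ?X (restrict \<omega> {0..<Suc (n + m)}) * (\<integral>\<^sup>+y. ?g y \<partial>P (\<omega> (n + m))) \<partial>?L)"
    by (intro nn_integral_chain_law_step ker x X) simp
  also have "\<dots> = (\<integral>\<^sup>+\<omega>. indicator B (restrict \<omega> {0..<Suc n}) *
        (indicator {\<omega>. \<forall>i\<le>m. \<omega> (n + i) \<in> A i} \<omega> * (\<lambda>z. \<integral>\<^sup>+y. ?g y \<partial>P z) (\<omega> (n + m))) \<partial>?L)"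
    by (intro nn_integral_cong) (simp only: eq mult.assoc)
  also have "\<dots> = (\<integral>\<^sup>+\<omega>. indicator B (restrict \<omega> {0..<Suc n}) *
      rectangle_op P A m (\<lambda>z. \<integral>\<^sup>+y. ?g y \<partial>P z) (\<omega> n) \<partial>?L)"
    by (rule Suc.IH) measurable
   finally show ?case by (simp only: rectangle_op.simps)
qed

lemma nn_integral_chain_law_initial:
  assumes ker: "markov_kernel N P" and x: "x \<in> space N" and f[measurable]: "f \<in> borel_measurable N"
  shows "(\<integral>\<^sup>+\<omega>. f (\<omega> 0) \<partial>chain_law N P x) = f x"
proof -
  have [measurable_cong]: "sets (chain_law N P x) = sets (path_space N)"
    by (rule sets_chain_law[OF ker x])
  have "distr (chain_law N P x) N (\<lambda>\<omega>. \<omega> 0) = return N x"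
  proof (rule measure_eqI)
    fix A assume "A \<in> sets (distr (chain_law N P x) N (\<lambda>\<omega>. \<omega> 0))"
    then have A: "A \<in> sets N" by simp
    have "(\<lambda>\<omega>. \<omega> 0) -` A \<inter> space (chain_law N P x) = {\<omega>\<in>space (path_space N). \<omega> 0 \<in> A}"
      using sets_eq_imp_space_eq[OF sets_chain_law[OF ker x]] by auto
    then show "emeasure (distr (chain_law N P x) N (\<lambda>\<omega>. \<omega> 0)) A = emeasure (return N x) A"
      using A chain_law_initial[OF ker x A] by (simp add: emeasure_distr)
  qed simp
  then have "(\<integral>\<^sup>+z. f z \<partial>distr (chain_law N P x) N (\<lambda>\<omega>. \<omega> 0)) = f x"
    using x by (simp add: nn_integral_return)
  then show ?thesis by (subst (asm) nn_integral_distr) simp_all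
qed

lemma emeasure_chain_law_rectangle:
  assumes ker: "markov_kernel N P" and x: "x \<in> space N" and A[measurable]: "\<And>i. A i \<in> sets N"
  shows "emeasure (chain_law N P x) {\<omega>\<in>space (path_space N). \<forall>i\<le>m. \<omega> i \<in> A i} =
           rectangle_op P A m (\<lambda>_. 1) x"
proof -
  note [measurable] = measurable_rectangle_op[OF ker]
  have s[measurable_cong]: "sets (chain_law N P x) = sets (path_space N)"
    by (rule sets_chain_law[OF ker x])
  let ?S = "space (PiM {0..<Suc 0} (\<lambda>_. N))"
  have S: "indicator ?S (restrict \<omega> {0..<Suc 0}) = (1::ennreal)" if "\<omega> \<in> space (chain_law N P x)" for \<omega>
    using that by (auto simp: sets_eq_imp_space_eq[OF s] space_PiM indicator_def)
  have "emeasure (chain_law N P x) {\<omega>\<in>space (path_space N). \<forall>i\<le>m. \<omega> i \<in> A i} =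
     (\<integral>\<^sup>+\<omega>. indicator {\<omega>\<in>space (path_space N). \<forall>i\<le>m. \<omega> i \<in> A i} \<omega> \<partial>chain_law N P x)"
    by (rule nn_integral_indicator[symmetric]) measurable
  also have "\<dots> = (\<integral>\<^sup>+\<omega>. indicator ?S (restrict \<omega> {0..<Suc 0}) *
      (indicator {\<omega>. \<forall>i\<le>m. \<omega> (0 + i) \<in> A i} \<omega> * (\<lambda>_. 1) (\<omega> (0 + m))) \<partial>chain_law N P x)"
    by (intro nn_integral_cong) (auto simp: indicator_def sets_eq_imp_space_eq[OF s] space_PiM)
  also have "\<dots> = (\<integral>\<^sup>+\<omega>. indicator ?S (restrict \<omega> {0..<Suc 0}) * rectangle_op P A m (\<lambda>_. 1) (\<omega> 0) \<partial>chain_law N P x)"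
    by (rule nn_integral_chain_law_rectangle[OF ker x]) auto
  also have "\<dots> = (\<integral>\<^sup>+\<omega>. rectangle_op P A m (\<lambda>_. 1) (\<omega> 0) \<partial>chain_law N P x)"
    by (intro nn_integral_cong) (simp only: S mult_1_left)
  also have "\<dots> = rectangle_op P A m (\<lambda>_. 1) x"
    by (rule nn_integral_chain_law_initial[OF ker x]) simp
  finally show ?thesis .
qed

text \<open>Makes \<open>chain_law N P\<close> a kernel, so that starting points can be averaged.
  Testing on rectangles suffices, since they generate the path space and are stable under
  intersection; there the probability is \<open>rectangle_op\<close> applied to the constant
  1.\<close>

lemma measurable_chain_law:
  assumes ker: "markov_kernel N P"
  shows "chain_law N P \<in> measurable N (prob_algebra (path_space N))"
proof (rule measurable_prob_algebra_generated[OF sets_PiM Int_stable_prod_algebra prod_algebra_sets_into_space])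
  fix R :: "(nat \<Rightarrow> 'a) set" assume "R \<in> prod_algebra UNIV (\<lambda>_. N)"
  from prod_algebra_path_rectangle[OF this]
  obtain A m where "(\<forall>i. A i \<in> sets N) \<and> R = {\<omega>\<in>space (path_space N). \<forall>i\<le>m. \<omega> i \<in> A i}"
    by (elim exE)
  then have A: "\<And>i. A i \<in> sets N" "R = {\<omega>\<in>space (path_space N). \<forall>i\<le>m. \<omega> i \<in> A i}" by auto
  show "(\<lambda>x. emeasure (chain_law N P x) R) \<in> borel_measurable N"
    using measurable_rectangle_op[OF ker, of A "\<lambda>_. 1" m] 
    by (simp add: A emeasure_chain_law_rectangle[OF ker] cong: measurable_cong)
qed (simp_all add: ker prob_space_chain_law sets_chain_law)

text \<open>As functions of D both sides are finite measures on the path space; they agree on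
  rectangles by \<open>nn_integral_chain_law_rectangle\<close>, hence everywhere. This is the Markov
  property at time n for events of the whole future.\<close>

lemma chain_law_markov:
  assumes ker: "markov_kernel N P" and x: "x \<in> space N"
    and B: "B \<in> sets (PiM {0..<Suc n} (\<lambda>_. N))" and D: "D \<in> sets (path_space N)"
  shows "emeasure (chain_law N P x)
           {\<omega>\<in>space (path_space N). restrict \<omega> {0..<Suc n} \<in> B \<and> (\<lambda>i. \<omega> (n + i)) \<in> D} =
         (\<integral>\<^sup>+\<omega>. indicator B (restrict \<omega> {0..<Suc n}) * emeasure (chain_law N P (\<omega> n)) D \<partial>chain_law N P x)"
proof -
  let ?L = "chain_law N P x" and ?S = "path_space N" and ?B = "\<lambda>\<omega>. indicator B (restrict \<omega> {0..<Suc n}) :: ennreal"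
  interpret L: prob_space ?L by (rule prob_space_chain_law[OF ker x])
  have s[measurable_cong]: "sets ?L = sets ?S"
    by (rule sets_chain_law[OF ker x])
  note sp = sets_eq_imp_space_eq[OF s]
  have Bm: "?B \<in> borel_measurable ?L"
    unfolding measurable_cong_sets[OF s refl]
    by (rule measurable_compose[OF measurable_restrict_path borel_measurable_indicator[OF B]])
  \<comment> \<open>Both measures first restrict to the event given by B. Then \<open>\<nu>1\<close>
    follows the actual path from time n on, while \<open>\<nu>2\<close> restarts the chain at the
    state \<open>\<omega> n\<close>.\<close>
  define \<nu>1 where "\<nu>1 = distr (density ?L ?B) ?S (\<lambda>\<omega> i. \<omega> (n + i))"
  define \<nu>2 where "\<nu>2 = density ?L ?B \<bind> (\<lambda>\<omega>. chain_law N P (\<omega> n))"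
  have \<theta>: "(\<lambda>\<omega> i. \<omega> (n + i)) \<in> measurable ?S ?S"
    by (rule measurable_PiM_single') (auto simp: space_PiM)
  have X: "{\<omega>\<in>space ?S. restrict \<omega> {0..<Suc n} \<in> B \<and> (\<lambda>i. \<omega> (n + i)) \<in> D} \<in> sets ?L"
    if D: "D \<in> sets ?S" for D
  proof -
    have *: "{\<omega>\<in>space ?S. restrict \<omega> {0..<Suc n} \<in> B \<and> (\<lambda>i. \<omega> (n + i)) \<in> D} =
        ((\<lambda>\<omega>. restrict \<omega> {0..<Suc n}) -` B \<inter> space ?S) \<inter> ((\<lambda>\<omega> i. \<omega> (n + i)) -` D \<inter> space ?S)"
      by auto
    show ?thesis
      unfolding s * by (intro sets.Int measurable_sets[OF measurable_restrict_path B] measurable_sets[OF \<theta> D])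
  qed
  have e1: "emeasure \<nu>1 D = emeasure ?L {\<omega>\<in>space ?S. restrict \<omega> {0..<Suc n} \<in> B \<and> (\<lambda>i. \<omega> (n + i)) \<in> D}"
    if D: "D \<in> sets ?S" for D
  proof -
    have "emeasure \<nu>1 D = emeasure (density ?L ?B) ((\<lambda>\<omega> i. \<omega> (n + i)) -` D \<inter> space ?S)"
      unfolding \<nu>1_def using \<theta> D by (subst emeasure_distr) (simp_all add: sp measurable_cong_sets[OF s refl])
    also have "\<dots> = (\<integral>\<^sup>+\<omega>. ?B \<omega> * indicator ((\<lambda>\<omega> i. \<omega> (n + i)) -` D \<inter> space ?S) \<omega> \<partial>?L)"
      using Bm measurable_sets[OF \<theta> D] by (intro emeasure_density) (simp_all only: s)
    also have "\<dots> = (\<integral>\<^sup>+\<omega>. indicator {\<omega>\<in>space ?S. restrict \<omega> {0..<Suc n} \<in> B \<and> (\<lambda>i. \<omega> (n + i)) \<in> D} \<omega> \<partial>?L)"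
      by (intro nn_integral_cong) (auto simp: indicator_def)
    also have "\<dots> = emeasure ?L {\<omega>\<in>space ?S. restrict \<omega> {0..<Suc n} \<in> B \<and> (\<lambda>i. \<omega> (n + i)) \<in> D}"
      by (rule nn_integral_indicator[OF X[OF D]])
    finally show ?thesis .
  qed
  have \<omega>n: "(\<lambda>\<omega>. \<omega> n) \<in> measurable ?L N"
    unfolding measurable_cong_sets[OF s refl] by (rule measurable_component_singleton) simp
  note K = measurable_compose[OF \<omega>n measurable_prob_algebraD[OF measurable_chain_law[OF ker]]]
  have e2: "emeasure \<nu>2 D = (\<integral>\<^sup>+\<omega>. ?B \<omega> * emeasure (chain_law N P (\<omega> n)) D \<partial>?L)"
    if D: "D \<in> sets ?S" for D
  proof -
    have "emeasure \<nu>2 D = (\<integral>\<^sup>+\<omega>. emeasure (chain_law N P (\<omega> n)) D \<partial>density ?L ?B)"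
      unfolding \<nu>2_def using L.not_empty K D by (intro emeasure_bind[where N="?S"]) simp_all
    also have "\<dots> = (\<integral>\<^sup>+\<omega>. ?B \<omega> * emeasure (chain_law N P (\<omega> n)) D \<partial>?L)"
      by (intro nn_integral_density Bm measurable_compose[OF K measurable_emeasure_subprob_algebra] D)
    finally show ?thesis .
  qed
  have "\<nu>1 = \<nu>2"
  proof (rule measure_eqI_PiM_infinite)
    show "sets \<nu>1 = ?S" by (simp add: \<nu>1_def)
    show "sets \<nu>2 = ?S" unfolding \<nu>2_def using L.not_empty measurable_space[OF \<omega>n]
      by (intro sets_bind) (simp_all add: sets_chain_law[OF ker])
    have "emeasure \<nu>1 (space \<nu>1) \<le> 1"
      using e1[of "space ?S"] L.emeasure_le_1 by (simp add: \<nu>1_def)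
    then show "finite_measure \<nu>1" by (intro finite_measureI) (auto simp: top_unique)
    fix E and J :: "nat set" assume J: "finite J" "\<And>i. i \<in> J \<Longrightarrow> E i \<in> sets N"
    have "\<exists>A m. (\<forall>i. A i \<in> sets N) \<and>
        prod_emb UNIV (\<lambda>_. N) J (Pi\<^sub>E J E) = {\<omega>\<in>space ?S. \<forall>i\<le>m. \<omega> i \<in> A i}"
      by (rule prod_emb_path_rectangle) (fact J)+
    then obtain A m where "(\<forall>i. A i \<in> sets N) \<and>
        prod_emb UNIV (\<lambda>_. N) J (Pi\<^sub>E J E) = {\<omega>\<in>space ?S. \<forall>i\<le>m. \<omega> i \<in> A i}"
      by (elim exE)
    then have A[measurable]: "\<And>i. A i \<in> sets N"
      and eq: "prod_emb UNIV (\<lambda>_. N) J (Pi\<^sub>E J E) = {\<omega>\<in>space ?S. \<forall>i\<le>m. \<omega> i \<in> A i}"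
      by auto
    have R: "{\<omega>\<in>space ?S. \<forall>i\<le>m. \<omega> i \<in> A i} \<in> sets ?S" by measurable
    have "(\<integral>\<^sup>+\<omega>. indicator {\<omega>\<in>space ?S. restrict \<omega> {0..<Suc n} \<in> B \<and>
          (\<lambda>i. \<omega> (n + i)) \<in> {\<omega>\<in>space ?S. \<forall>i\<le>m. \<omega> i \<in> A i}} \<omega> \<partial>?L) =
      (\<integral>\<^sup>+\<omega>. ?B \<omega> * (indicator {\<omega>. \<forall>i\<le>m. \<omega> (n + i) \<in> A i} \<omega> * (\<lambda>_. 1) (\<omega> (n + m))) \<partial>?L)"
      by (intro nn_integral_cong) (auto simp: indicator_def sp space_PiM)
    also have "\<dots> = (\<integral>\<^sup>+\<omega>. ?B \<omega> * rectangle_op P A m (\<lambda>_. 1) (\<omega> n) \<partial>?L)"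
      by (rule nn_integral_chain_law_rectangle[OF ker x B A]) simp
    also have "\<dots> = (\<integral>\<^sup>+\<omega>. ?B \<omega> * emeasure (chain_law N P (\<omega> n)) {\<omega>\<in>space ?S. \<forall>i\<le>m. \<omega> i \<in> A i} \<partial>?L)"
      by (intro nn_integral_cong, subst emeasure_chain_law_rectangle[OF ker])
         (simp_all add: measurable_space[OF \<omega>n] A)
    finally show "emeasure \<nu>1 (prod_emb UNIV (\<lambda>_. N) J (Pi\<^sub>E J E)) = emeasure \<nu>2 (prod_emb UNIV (\<lambda>_. N) J (Pi\<^sub>E J E))"
      unfolding eq e1[OF R] e2[OF R] nn_integral_indicator[OF X[OF R]] .
  qed
  then show ?thesis using e1[OF D] e2[OF D] by simp
qed

section \<open>The stationary chain and its invariant events\<close>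

text \<open>The chain with random initial state of law \<mu>; for invariant \<mu> it is stationary,
  see \<open>distr_shift\<close>.\<close>

definition path_law :: "'a measure \<Rightarrow> ('a \<Rightarrow> 'a measure) \<Rightarrow> 'a measure \<Rightarrow> (nat \<Rightarrow> 'a) measure" where
  "path_law N P \<mu> = \<mu> \<bind> chain_law N P"

lemma measurable_shift: "(\<lambda>\<omega> i. \<omega> (n + i)) \<in> measurable (path_space N) (path_space N)"
  by (rule measurable_PiM_single') (auto simp: space_PiM)

lemma chain_law_markov_shift:
  assumes ker: "markov_kernel N P" and x: "x \<in> space N" and D: "D \<in> sets (path_space N)"
  shows "emeasure (chain_law N P x) {\<omega>\<in>space (path_space N). (\<lambda>i. \<omega> (n + i)) \<in> D} =
         (\<integral>\<^sup>+\<omega>. emeasure (chain_law N P (\<omega> n)) D \<partial>chain_law N P x)"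
proof -
  let ?B = "space (PiM {0..<Suc n} (\<lambda>_. N))"
  have r: "restrict \<omega> {0..<Suc n} \<in> ?B" if "\<omega> \<in> space (path_space N)" for \<omega>
    using that by (auto simp: space_PiM)
  have "{\<omega>\<in>space (path_space N). (\<lambda>i. \<omega> (n + i)) \<in> D} =
      {\<omega>\<in>space (path_space N). restrict \<omega> {0..<Suc n} \<in> ?B \<and> (\<lambda>i. \<omega> (n + i)) \<in> D}"
    using r by blast
  then have "emeasure (chain_law N P x) {\<omega>\<in>space (path_space N). (\<lambda>i. \<omega> (n + i)) \<in> D} =
      (\<integral>\<^sup>+\<omega>. indicator ?B (restrict \<omega> {0..<Suc n}) * emeasure (chain_law N P (\<omega> n)) D \<partial>chain_law N P x)"
    using chain_law_markov[OF ker x sets.top D] by simp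
  also have "\<dots> = (\<integral>\<^sup>+\<omega>. emeasure (chain_law N P (\<omega> n)) D \<partial>chain_law N P x)"
    using r sets_eq_imp_space_eq[OF sets_chain_law[OF ker x]]
    by (intro nn_integral_cong) (simp only: indicator_simps mult_1_left)
  finally show ?thesis .
qed

lemma nn_integral_chain_law_first_step:
  assumes ker: "markov_kernel N P" and x: "x \<in> space N" and f: "f \<in> borel_measurable N"
  shows "(\<integral>\<^sup>+\<omega>. f (\<omega> (Suc 0)) \<partial>chain_law N P x) = (\<integral>\<^sup>+y. f y \<partial>P x)"
proof -
  let ?B = "space (PiM {0..<Suc 0} (\<lambda>_. N))"
  have r: "indicator ?B (restrict \<omega> {0..<Suc 0}) = (1::ennreal)" if "\<omega> \<in> space (chain_law N P x)" for \<omega>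
    using that sets_eq_imp_space_eq[OF sets_chain_law[OF ker x]] by (auto simp: space_PiM indicator_def)
  have "(\<integral>\<^sup>+\<omega>. f (\<omega> (Suc 0)) \<partial>chain_law N P x) =
      (\<integral>\<^sup>+\<omega>. indicator ?B (restrict \<omega> {0..<Suc 0}) * f (\<omega> (Suc 0)) \<partial>chain_law N P x)"
    by (intro nn_integral_cong) (simp only: r mult_1_left)
  also have "\<dots> = (\<integral>\<^sup>+\<omega>. indicator ?B (restrict \<omega> {0..<Suc 0}) * (\<integral>\<^sup>+y. f y \<partial>P (\<omega> 0)) \<partial>chain_law N P x)"
    by (rule nn_integral_chain_law_step[OF ker x sets.top f])
  also have "\<dots> = (\<integral>\<^sup>+\<omega>. (\<integral>\<^sup>+y. f y \<partial>P (\<omega> 0)) \<partial>chain_law N P x)"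
    by (intro nn_integral_cong) (simp only: r mult_1_left)
  also have "\<dots> = (\<integral>\<^sup>+y. f y \<partial>P x)"
    using measurable_compose[OF markov_kernel_measurable[OF ker] nn_integral_measurable_subprob_algebra[OF f]]
    by (rule nn_integral_chain_law_initial[OF ker x])
  finally show ?thesis .
qed

locale stationary_chain = prob_space \<mu> for \<mu> :: "'a measure" +
  fixes N :: "'a measure" and P :: "'a \<Rightarrow> 'a measure"
  assumes ker: "markov_kernel N P" and sets_\<mu>: "sets \<mu> = sets N"
    and invariant: "A \<in> sets N \<Longrightarrow> (\<integral>\<^sup>+x. emeasure (P x) A \<partial>\<mu>) = emeasure \<mu> A"
begin

abbreviation "S \<equiv> path_space N"
abbreviation "L \<equiv> chain_law N P"
abbreviation "Q \<equiv> path_law N P \<mu>"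

lemma space_\<mu>: "space \<mu> = space N"
  by (rule sets_eq_imp_space_eq[OF sets_\<mu>])

lemma measurable_L: "L \<in> measurable \<mu> (subprob_algebra S)"
  unfolding measurable_cong_sets[OF sets_\<mu> refl]
  by (rule measurable_prob_algebraD[OF measurable_chain_law[OF ker]])

lemma sets_Q: "sets Q = sets S"
  unfolding path_law_def using not_empty
  by (intro sets_bind) (simp_all add: sets_chain_law[OF ker] space_\<mu>)

lemma space_Q: "space Q = space S"
  by (rule sets_eq_imp_space_eq[OF sets_Q])

lemma emeasure_Q: "D \<in> sets S \<Longrightarrow> emeasure Q D = (\<integral>\<^sup>+x. emeasure (L x) D \<partial>\<mu>)"
  unfolding path_law_def using not_empty measurable_L by (rule emeasure_bind)

lemma nn_integral_Q:
  "f \<in> borel_measurable S \<Longrightarrow> (\<integral>\<^sup>+\<omega>. f \<omega> \<partial>Q) = (\<integral>\<^sup>+x. \<integral>\<^sup>+\<omega>. f \<omega> \<partial>L x \<partial>\<mu>)"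
  unfolding path_law_def using measurable_L by (intro nn_integral_bind)

sublocale Q: prob_space Q
  unfolding path_law_def
  by (rule prob_space_bind[OF _ measurable_L], rule AE_I2)
    (simp add: space_\<mu> prob_space_chain_law[OF ker])

lemma measurable_P: "P \<in> measurable \<mu> (subprob_algebra N)"
  unfolding measurable_cong_sets[OF sets_\<mu> refl] by (rule markov_kernel_measurable[OF ker])

lemma bind_P: "\<mu> \<bind> P = \<mu>"
proof (rule measure_eqI)
  show s: "sets (\<mu> \<bind> P) = sets \<mu>"
    using not_empty ker by (subst sets_bind[where N=N]) (auto simp: markov_kernel_def space_\<mu> sets_\<mu>)
  fix A assume "A \<in> sets (\<mu> \<bind> P)"
  then have A: "A \<in> sets N" by (simp add: s sets_\<mu>)
  show "emeasure (\<mu> \<bind> P) A = emeasure \<mu> A"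
    unfolding emeasure_bind[OF not_empty measurable_P A] by (rule invariant[OF A])
qed

lemma emeasure_L_measurable:
  assumes "D \<in> sets S"
  shows "(\<lambda>x. emeasure (L x) D) \<in> borel_measurable N"
  using measurable_compose[OF measurable_L measurable_emeasure_subprob_algebra[OF assms]]
  by (simp add: measurable_cong_sets[OF sets_\<mu> refl])

text \<open>By the Markov property at time 1, the shifted path is a chain started from the first
  step; averaged over \<mu>, that step has law \<open>\<mu> \<bind> P\<close>, which is \<mu>. The
  maximal ergodic inequality and the equality of all one-time laws rest on this.\<close>

lemma distr_shift: "distr Q S (\<lambda>\<omega> i. \<omega> (Suc i)) = Q"
proof (rule measure_eqI)
  fix D assume "D \<in> sets (distr Q S (\<lambda>\<omega> i. \<omega> (Suc i)))"
  then have D: "D \<in> sets S" by simp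
  note \<theta> = measurable_shift[of "Suc 0", simplified]
  have "emeasure (distr Q S (\<lambda>\<omega> i. \<omega> (Suc i))) D = emeasure Q {\<omega>\<in>space S. (\<lambda>i. \<omega> (Suc i)) \<in> D}"
    using \<theta> D by (subst emeasure_distr)
      (auto simp: measurable_cong_sets[OF sets_Q refl] space_Q intro!: arg_cong[where f="emeasure Q"])
  also have "\<dots> = (\<integral>\<^sup>+x. emeasure (L x) {\<omega>\<in>space S. (\<lambda>i. \<omega> (Suc 0 + i)) \<in> D} \<partial>\<mu>)"
    using measurable_sets[OF \<theta> D] by (subst emeasure_Q) (simp_all add: vimage_def Int_def conj_commute)
  also have "\<dots> = (\<integral>\<^sup>+x. \<integral>\<^sup>+y. emeasure (L y) D \<partial>P x \<partial>\<mu>)"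
  proof (rule nn_integral_cong)
    fix x assume "x \<in> space \<mu>"
    then have x: "x \<in> space N" by (simp add: space_\<mu>)
    show "emeasure (L x) {\<omega>\<in>space S. (\<lambda>i. \<omega> (Suc 0 + i)) \<in> D} = (\<integral>\<^sup>+y. emeasure (L y) D \<partial>P x)"
      unfolding chain_law_markov_shift[OF ker x D]
      by (rule nn_integral_chain_law_first_step[OF ker x emeasure_L_measurable[OF D]])
  qed
  also have "\<dots> = (\<integral>\<^sup>+y. emeasure (L y) D \<partial>(\<mu> \<bind> P))"
    using emeasure_L_measurable[OF D] measurable_P by (rule nn_integral_bind[symmetric])
  also have "\<dots> = emeasure Q D"
    using D by (simp add: bind_P emeasure_Q)
  finally show "emeasure (distr Q S (\<lambda>\<omega> i. \<omega> (Suc i))) D = emeasure Q D" .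
qed (simp add: sets_Q)

lemma measurable_coordinate: "(\<lambda>\<omega>. \<omega> n) \<in> measurable Q N"
  unfolding measurable_cong_sets[OF sets_Q refl] by (rule measurable_component_singleton) simp

lemma nn_integral_Q_coordinate:
  assumes f: "f \<in> borel_measurable N"
  shows "(\<integral>\<^sup>+\<omega>. f (\<omega> n) \<partial>Q) = (\<integral>\<^sup>+x. f x \<partial>\<mu>)"
proof (induction n)
  case 0
  have "(\<integral>\<^sup>+\<omega>. f (\<omega> 0) \<partial>Q) = (\<integral>\<^sup>+x. \<integral>\<^sup>+\<omega>. f (\<omega> 0) \<partial>L x \<partial>\<mu>)"
    using measurable_compose[OF measurable_coordinate f]
    by (intro nn_integral_Q) (simp add: measurable_cong_sets[OF sets_Q refl])
  also have "\<dots> = (\<integral>\<^sup>+x. f x \<partial>\<mu>)"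
    by (intro nn_integral_cong nn_integral_chain_law_initial[OF ker] f) (simp add: space_\<mu>)
  finally show ?case .
next
  case (Suc n)
  note \<theta> = measurable_shift[of "Suc 0", simplified]
  have "(\<integral>\<^sup>+\<omega>. f (\<omega> (Suc n)) \<partial>Q) = (\<integral>\<^sup>+\<omega>. f (\<omega> n) \<partial>distr Q S (\<lambda>\<omega> i. \<omega> (Suc i)))"
    using \<theta> measurable_compose[OF measurable_coordinate f, of n]
    by (subst nn_integral_distr) (simp_all add: measurable_cong_sets[OF sets_Q refl])
  also have "\<dots> = (\<integral>\<^sup>+\<omega>. f (\<omega> n) \<partial>Q)"
    by (simp only: distr_shift)
  finally show ?case using Suc by simp
qed

lemma distr_coordinate: "distr Q N (\<lambda>\<omega>. \<omega> n) = \<mu>"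
proof (rule measure_eqI)
  fix A assume "A \<in> sets (distr Q N (\<lambda>\<omega>. \<omega> n))"
  then have A: "A \<in> sets N" by simp
  have "emeasure (distr Q N (\<lambda>\<omega>. \<omega> n)) A = (\<integral>\<^sup>+x. indicator A x \<partial>distr Q N (\<lambda>\<omega>. \<omega> n))"
    using A by simp
  also have "\<dots> = (\<integral>\<^sup>+\<omega>. indicator A (\<omega> n) \<partial>Q)"
    using A measurable_coordinate by (intro nn_integral_distr) simp_all
  also have "\<dots> = emeasure \<mu> A"
    using A by (simp add: nn_integral_Q_coordinate sets_\<mu>)
  finally show "emeasure (distr Q N (\<lambda>\<omega>. \<omega> n)) A = emeasure \<mu> A" .
qed (simp add: sets_\<mu>)

lemma shift_invariant_iff:
  assumes inv: "\<And>\<omega>. \<omega> \<in> space S \<Longrightarrow> (\<lambda>i. \<omega> (Suc i)) \<in> D \<longleftrightarrow> \<omega> \<in> D" and "\<omega> \<in> space S"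
  shows "(\<lambda>i. \<omega> (n + i)) \<in> D \<longleftrightarrow> \<omega> \<in> D"
proof (induction n)
  case (Suc n)
  have "(\<lambda>i. \<omega> (n + i)) \<in> space S"
    using \<open>\<omega> \<in> space S\<close> by (auto simp: space_PiM)
  from inv[OF this] Suc show ?case by simp
qed simp

text \<open>By invariance D can be read off from the path after time n, while R involves only times
  up to m \<le> n. The Markov property at time n then replaces D by its conditional probability
  given \<open>\<omega> n\<close>.\<close>

lemma emeasure_Q_invariant_Int_rectangle:
  assumes D: "D \<in> sets S" and inv: "\<And>\<omega>. \<omega> \<in> space S \<Longrightarrow> (\<lambda>i. \<omega> (Suc i)) \<in> D \<longleftrightarrow> \<omega> \<in> D"
    and A: "\<And>i. A i \<in> sets N" and "m \<le> n"
  defines "R \<equiv> {\<omega>\<in>space S. \<forall>i\<le>m. \<omega> i \<in> A i}"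
  shows "emeasure Q (D \<inter> R) = (\<integral>\<^sup>+\<omega>. emeasure (L (\<omega> n)) D * indicator R \<omega> \<partial>Q)"
proof -
  define B where "B = {\<omega>\<in>space (PiM {0..<Suc n} (\<lambda>_. N)). \<forall>i\<in>{..m}. \<omega> i \<in> A i}"
  have c: "(\<lambda>\<omega>. \<omega> i) \<in> measurable (PiM {0..<Suc n} (\<lambda>_. N)) N" if "i \<le> m" for i
    by (rule measurable_component_singleton) (use that \<open>m \<le> n\<close> in auto)
  have "{\<omega>\<in>space (PiM {0..<Suc n} (\<lambda>_. N)). \<omega> i \<in> A i} \<in> sets (PiM {0..<Suc n} (\<lambda>_. N))" if "i \<le> m" for i
  proof -
    have "{\<omega>\<in>space (PiM {0..<Suc n} (\<lambda>_. N)). \<omega> i \<in> A i} = (\<lambda>\<omega>. \<omega> i) -` A i \<inter> space (PiM {0..<Suc n} (\<lambda>_. N))"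
      by auto
    then show ?thesis using c[OF that] A[of i] by (simp add: measurable_sets)
  qed
  then have B: "B \<in> sets (PiM {0..<Suc n} (\<lambda>_. N))"
    unfolding B_def by (intro sets.sets_Collect_finite_All') auto
  have R_sub: "R \<subseteq> space S" by (auto simp: R_def)
  have rB: "restrict \<omega> {0..<Suc n} \<in> B \<longleftrightarrow> \<omega> \<in> R" if "\<omega> \<in> space S" for \<omega>
    using that \<open>m \<le> n\<close> by (auto simp: R_def B_def space_PiM)
  have "R = (\<lambda>\<omega>. restrict \<omega> {0..<Suc n}) -` B \<inter> space S"
    using rB R_sub by blast
  then have R: "R \<in> sets S"
    using measurable_sets[OF measurable_restrict_path B] by simp
  have "emeasure Q (D \<inter> R) = (\<integral>\<^sup>+x. emeasure (L x) (D \<inter> R) \<partial>\<mu>)"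
    using D R by (intro emeasure_Q) auto
  also have "\<dots> = (\<integral>\<^sup>+x. \<integral>\<^sup>+\<omega>. emeasure (L (\<omega> n)) D * indicator R \<omega> \<partial>L x \<partial>\<mu>)"
  proof (rule nn_integral_cong)
    fix x assume "x \<in> space \<mu>"
    then have x: "x \<in> space N" by (simp add: space_\<mu>)
    have "D \<inter> R = {\<omega>\<in>space S. restrict \<omega> {0..<Suc n} \<in> B \<and> (\<lambda>i. \<omega> (n + i)) \<in> D}"
      using rB R_sub shift_invariant_iff[OF inv] sets.sets_into_space[OF D] by blast
    then have "emeasure (L x) (D \<inter> R) =
        (\<integral>\<^sup>+\<omega>. indicator B (restrict \<omega> {0..<Suc n}) * emeasure (L (\<omega> n)) D \<partial>L x)"
      using chain_law_markov[OF ker x B D] by simp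
    also have "\<dots> = (\<integral>\<^sup>+\<omega>. emeasure (L (\<omega> n)) D * indicator R \<omega> \<partial>L x)"
    proof (rule nn_integral_cong)
      fix \<omega> assume "\<omega> \<in> space (L x)"
      then have "\<omega> \<in> space S" using sets_eq_imp_space_eq[OF sets_chain_law[OF ker x]] by simp
      from rB[OF this] show "indicator B (restrict \<omega> {0..<Suc n}) * emeasure (L (\<omega> n)) D = emeasure (L (\<omega> n)) D * indicator R \<omega>"
        by (simp only: indicator_def mult.commute of_bool_def)
    qed
    finally show "emeasure (L x) (D \<inter> R) = (\<integral>\<^sup>+\<omega>. emeasure (L (\<omega> n)) D * indicator R \<omega> \<partial>L x)" .
  qed
  also have "\<dots> = (\<integral>\<^sup>+\<omega>. emeasure (L (\<omega> n)) D * indicator R \<omega> \<partial>Q)"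
  proof (rule nn_integral_Q[symmetric])
    show "(\<lambda>\<omega>. emeasure (L (\<omega> n)) D * indicator R \<omega>) \<in> borel_measurable S"
      unfolding measurable_cong_sets[OF sets_Q[symmetric] refl]
      using measurable_compose[OF measurable_coordinate emeasure_L_measurable[OF D], of n]
        borel_measurable_indicator[of R Q, where 'b=ennreal] R
      by (simp add: sets_Q)
  qed
  finally show ?thesis .
qed

text \<open>A shift-invariant event has conditional probability \<open>u (\<omega> n)\<close> given the first \<open>n + 1\<close> states,
  where \<open>u x\<close> is its probability for the chain started at \<open>x\<close>. Hence \<open>\<integral>\<^sub>B u (\<omega> n) dQ\<close> tends to
  \<open>Q (D \<inter> B)\<close> for every event \<open>B\<close>; with \<open>B = D\<close> and its complement, and as \<open>\<omega> n\<close> has law \<open>\<mu>\<close>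
  for all \<open>n\<close>, this forces \<open>\<integral> u (1 - u) d\<mu> = 0\<close>.\<close>

lemma AE_invariant_zero_one:
  assumes D: "D \<in> sets S" and inv: "\<And>\<omega>. \<omega> \<in> space S \<Longrightarrow> (\<lambda>i. \<omega> (Suc i)) \<in> D \<longleftrightarrow> \<omega> \<in> D"
  shows "AE x in \<mu>. emeasure (L x) D = 0 \<or> emeasure (L x) D = 1"
proof -
  define u where "u x = measure (L x) D" for x
  have u: "emeasure (L x) D = ennreal (u x)" "0 \<le> u x" "u x \<le> 1" if "x \<in> space N" for x
  proof -
    interpret Lx: prob_space "L x" by (rule prob_space_chain_law[OF ker that])
    show "emeasure (L x) D = ennreal (u x)" "0 \<le> u x" "u x \<le> 1"
      by (simp_all add: u_def Lx.emeasure_eq_measure)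
  qed
  have um: "u \<in> borel_measurable N"
    unfolding u_def measure_def using emeasure_L_measurable[OF D] by measurable
  have unm: "(\<lambda>\<omega>. u (\<omega> n)) \<in> borel_measurable Q" for n
    using measurable_compose[OF measurable_coordinate um] .
  have sp: "\<omega> n \<in> space N" if "\<omega> \<in> space Q" for \<omega> n
    using measurable_space[OF measurable_coordinate that] .
  \<comment> \<open>Q weighted by the conditional probability of D given the state at time n. On a
    rectangle of times up to m it agrees with Q restricted to D as soon as n \<ge> m
    (\<open>rect\<close>).\<close>
  define R where "R n = density Q (\<lambda>\<omega>. ennreal (u (\<omega> n)))" for n
  have sets_R: "sets (R n) = sets S" for n by (simp add: R_def sets_Q)
  have space_R: "space (R n) = space S" for n by (rule sets_eq_imp_space_eq[OF sets_R])
  have eR: "emeasure (R n) B = (\<integral>\<^sup>+\<omega>. ennreal (u (\<omega> n)) * indicator B \<omega> \<partial>Q)" if "B \<in> sets S" for B n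
    unfolding R_def using that unm by (intro emeasure_density) (simp_all add: sets_Q)
  have R_le: "emeasure (R n) B \<le> emeasure Q B" if B: "B \<in> sets S" for B n
  proof -
    have "emeasure (R n) B \<le> (\<integral>\<^sup>+\<omega>. indicator B \<omega> \<partial>Q)"
      unfolding eR[OF B] using u(3) sp by (intro nn_integral_mono) (auto simp: indicator_def)
    then show ?thesis using B by (simp add: sets_Q)
  qed
  have fR: "finite_measure (R n)" for n
    using R_le[OF sets.top, of n] Q.emeasure_space_1 by (intro finite_measureI) (auto simp: space_R space_Q top_unique)
  have R_le': "measure (R n) B \<le> measure Q B" if "B \<in> sets S" for B n
    using R_le[OF that, of n] finite_measure.emeasure_eq_measure[OF fR] Q.emeasure_eq_measure
    by simp
  have rect: "measure (R n) {\<omega>\<in>space S. \<forall>i\<le>m. \<omega> i \<in> A i} = measure Q (D \<inter> {\<omega>\<in>space S. \<forall>i\<le>m. \<omega> i \<in> A i})"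
    if A: "\<And>i. A i \<in> sets N" and "m \<le> n" for A m n
  proof -
    let ?B = "{\<omega>\<in>space S. \<forall>i\<le>m. \<omega> i \<in> A i}"
    note [measurable] = A
    have B: "?B \<in> sets S" by measurable
    have "emeasure Q (D \<inter> ?B) = (\<integral>\<^sup>+\<omega>. emeasure (L (\<omega> n)) D * indicator ?B \<omega> \<partial>Q)"
      by (rule emeasure_Q_invariant_Int_rectangle[OF D inv A \<open>m \<le> n\<close>])
    also have "\<dots> = emeasure (R n) ?B"
      unfolding eR[OF B] by (intro nn_integral_cong) (simp add: u(1) sp)
    finally show ?thesis by (simp add: measure_def)
  qed
  \<comment> \<open>General events are reached from rectangles through the Dynkin system that these
    generate, at the price of replacing equality for large n by convergence.\<close>
  have lim: "(\<lambda>n. measure (R n) B) \<longlonglongrightarrow> measure Q (D \<inter> B)" if "B \<in> sets S" for B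
    using that unfolding sets_PiM
  proof (induction rule: sigma_sets_induct_disjoint[OF Int_stable_prod_algebra prod_algebra_sets_into_space, consumes 1, case_names basic empty compl union])
    case (basic B)
    from prod_algebra_path_rectangle[OF this]
    obtain A m where "(\<forall>i. A i \<in> sets N) \<and> B = {\<omega>\<in>space S. \<forall>i\<le>m. \<omega> i \<in> A i}"
      by (elim exE)
    then have A: "\<And>i. A i \<in> sets N" "B = {\<omega>\<in>space S. \<forall>i\<le>m. \<omega> i \<in> A i}" by auto
    show ?case
      unfolding A(2) using rect[of A m] A(1) by (intro tendsto_eventually eventually_sequentiallyI[of m]) simp
  next
    case empty
    show ?case by simp
  next
    case (compl B)
    have B: "B \<in> sets S" using compl(1) by (simp add: sets_PiM)
    have "(\<lambda>n. measure (R n) (space S)) \<longlonglongrightarrow> measure Q (D \<inter> space S)"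
    proof -
      have "{\<omega>\<in>space S. \<forall>i\<le>0. \<omega> i \<in> space N} = space S" by (auto simp: space_PiM)
      then show ?thesis using rect[of "\<lambda>_. space N" 0] by simp
    qed
    then have "(\<lambda>n. measure (R n) (space S) - measure (R n) B) \<longlonglongrightarrow>
        measure Q (D \<inter> space S) - measure Q (D \<inter> B)"
      using compl(2) by (intro tendsto_diff)
    moreover have "measure (R n) (space S) - measure (R n) B = measure (R n) (space S - B)" for n
      using finite_measure.finite_measure_compl[OF fR, of B n] B by (simp add: sets_R space_R)
    moreover have "measure Q (D \<inter> space S) - measure Q (D \<inter> B) = measure Q (D \<inter> (space S - B))"
      using Q.finite_measure_Diff'[of "D \<inter> space S" "D \<inter> B"] B D sets.sets_into_space[OF B]
      by (simp add: sets_Q Diff_Int_distrib)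
    ultimately show ?case by (simp add: space_PiM)
  next
    case (union B)
    have B: "range B \<subseteq> sets S" "\<And>i. B i \<in> sets S" using union(2) by (auto simp: sets_PiM)
    have sR: "(\<lambda>i. measure (R n) (B i)) sums measure (R n) (\<Union>i. B i)" for n
      using finite_measure.finite_measure_UNION[OF fR] B union(1) by (simp add: sets_R)
    have sQ: "(\<lambda>i. measure Q (B i)) sums measure Q (\<Union>i. B i)"
      using Q.finite_measure_UNION B union(1) by (simp add: sets_Q)
    have sD: "(\<lambda>i. measure Q (D \<inter> B i)) sums measure Q (\<Union>i. D \<inter> B i)"
      using B D union(1)
      by (intro Q.finite_measure_UNION) (auto simp: sets_Q disjoint_family_on_def)
    \<comment> \<open>Limit and infinite sum may be exchanged because every \<open>R n\<close> is
      dominated by Q and the numbers \<open>measure Q (B i)\<close> are summable.\<close>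
    have "((\<lambda>n. \<Sum>i. measure (R n) (B i)) \<longlonglongrightarrow> (\<Sum>i. measure Q (D \<inter> B i)))"
    proof (rule tannerys_theorem[THEN conjunct2, THEN conjunct2])
      show "(\<lambda>n. measure (R n) (B i)) \<longlonglongrightarrow> measure Q (D \<inter> B i)" for i
        by (rule union(3))
      show "\<forall>\<^sub>F (k, n) in at_top \<times>\<^sub>F sequentially. norm (measure (R n) (B k)) \<le> measure Q (B k)"
        using R_le' B by (intro always_eventually) auto
    qed (use sQ in \<open>auto simp: sums_iff\<close>)
    then show ?case
      using sR sD by (simp add: sums_iff)
  qed
  have mR: "measure (R n) B = (\<integral>\<omega>. u (\<omega> n) * indicator B \<omega> \<partial>Q)" if B: "B \<in> sets S" for B n
  proof -
    have "(\<integral>\<omega>. u (\<omega> n) * indicator B \<omega> \<partial>Q) = enn2real (\<integral>\<^sup>+\<omega>. ennreal (u (\<omega> n) * indicator B \<omega>) \<partial>Q)"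
      using unm B u(2) sp
      by (intro integral_eq_nn_integral AE_I2 borel_measurable_times borel_measurable_indicator)
        (auto simp: sets_Q)
    also have "(\<integral>\<^sup>+\<omega>. ennreal (u (\<omega> n) * indicator B \<omega>) \<partial>Q) = emeasure (R n) B"
      unfolding eR[OF B] by (intro nn_integral_cong) (auto simp: indicator_def)
    finally show ?thesis by (simp add: measure_def)
  qed
  have int: "integrable Q (\<lambda>\<omega>. u (\<omega> n) * indicator B \<omega>)" if "B \<in> sets S" for B n
    using unm that u(2,3) sp
    by (intro Q.integrable_const_bound[of _ 1] AE_I2 borel_measurable_times borel_measurable_indicator)
      (auto simp: indicator_def sets_Q)
  have intD: "integrable Q (indicator D :: _ \<Rightarrow> real)"
    using D by (simp add: sets_Q Q.emeasure_eq_measure)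
  have Dc: "space S - D \<in> sets S" using D by simp
  \<comment> \<open>Since 0 \<le> u \<le> 1, the product u (1 - u) is at most 1 - u on D and at most
    u off D. By \<open>lim\<close> the integrals of these two bounds tend to Q(D) - Q(D) and to Q of
    the empty set.\<close>
  have "(\<integral>x. u x * (1 - u x) \<partial>\<mu>) \<le> measure Q D - measure (R n) D + measure (R n) (space S - D)" for n
  proof -
    have "(\<integral>x. u x * (1 - u x) \<partial>\<mu>) = (\<integral>x. u x * (1 - u x) \<partial>distr Q N (\<lambda>\<omega>. \<omega> n))"
      by (simp only: distr_coordinate)
    also have "\<dots> = (\<integral>\<omega>. u (\<omega> n) * (1 - u (\<omega> n)) \<partial>Q)"
      using um by (intro integral_distr measurable_coordinate) simp
    also have "\<dots> \<le> (\<integral>\<omega>. indicator D \<omega> - u (\<omega> n) * indicator D \<omega> + u (\<omega> n) * indicator (space S - D) \<omega> \<partial>Q)"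
    proof (rule integral_mono)
      show "integrable Q (\<lambda>\<omega>. u (\<omega> n) * (1 - u (\<omega> n)))"
        using unm u(2,3) sp by (intro Q.integrable_const_bound[of _ 1] AE_I2)
          (auto simp: abs_mult intro!: mult_le_one)
      show "integrable Q (\<lambda>\<omega>. indicator D \<omega> - u (\<omega> n) * indicator D \<omega> + u (\<omega> n) * indicator (space S - D) \<omega>)"
        using intD int[OF D] int[OF Dc] by simp
      fix \<omega> assume "\<omega> \<in> space Q"
      then show "u (\<omega> n) * (1 - u (\<omega> n)) \<le>
          indicator D \<omega> - u (\<omega> n) * indicator D \<omega> + u (\<omega> n) * indicator (space S - D) \<omega>"
        using u(2,3)[OF sp, of \<omega> n] mult_left_le_one_le[of "1 - u (\<omega> n)" "u (\<omega> n)"]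
          mult_right_le_one_le[of "u (\<omega> n)" "1 - u (\<omega> n)"]
        by (auto simp: indicator_def space_Q)
    qed
    also have "\<dots> = measure Q D - measure (R n) D + measure (R n) (space S - D)"
      using intD int[OF D] int[OF Dc] D sets.sets_into_space[OF D] by (simp add: mR sets_Q space_Q Int_absorb2)
    finally show ?thesis .
  qed
  moreover have "(\<lambda>n. measure Q D - measure (R n) D + measure (R n) (space S - D)) \<longlonglongrightarrow>
      measure Q D - measure Q (D \<inter> D) + measure Q (D \<inter> (space S - D))"
    using D by (intro tendsto_add tendsto_diff tendsto_const lim) auto
  ultimately have "(\<integral>x. u x * (1 - u x) \<partial>\<mu>) \<le> 0"
    by (intro LIMSEQ_le_const[of _ "0::real"]) (auto simp: Diff_disjoint)
  moreover have nn: "0 \<le> u x * (1 - u x)" if "x \<in> space \<mu>" for x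
    using u that by (simp add: space_\<mu>)
  ultimately have "(\<integral>x. u x * (1 - u x) \<partial>\<mu>) = 0"
    using Bochner_Integration.integral_nonneg[of \<mu> "\<lambda>x. u x * (1 - u x)"] by (intro antisym) auto
  moreover have "integrable \<mu> (\<lambda>x. u x * (1 - u x))"
    using um u by (intro integrable_const_bound[of _ 1] AE_I2)
      (auto simp: abs_mult space_\<mu> measurable_cong_sets[OF sets_\<mu> refl] intro!: mult_le_one)
  ultimately have "AE x in \<mu>. u x * (1 - u x) = 0"
    using nn by (subst (asm) integral_nonneg_eq_0_iff_AE) auto
  then show ?thesis
    by (rule AE_mp) (intro AE_I2, auto simp: u space_\<mu>)
qed

end

section \<open>The maximal ergodic inequality and upper frequencies\<close>

text \<open>This is the maximum of the Birkhoff sums \<open>\<Sum>i<n. f ((T ^^ i) x)\<close> over \<open>n \<le> m\<close>.\<close>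

primrec max_birkhoff_sum :: "('a \<Rightarrow> 'a) \<Rightarrow> ('a \<Rightarrow> real) \<Rightarrow> nat \<Rightarrow> 'a \<Rightarrow> real" where
  "max_birkhoff_sum T f 0 x = 0"
| "max_birkhoff_sum T f (Suc m) x = max 0 (f x + max_birkhoff_sum T f m (T x))"

lemma max_birkhoff_sum_nonneg: "0 \<le> max_birkhoff_sum T f m x"
  by (cases m) auto

lemma birkhoff_sum_le_max: "n \<le> m \<Longrightarrow> (\<Sum>i<n. f ((T ^^ i) x)) \<le> max_birkhoff_sum T f m x"
proof (induction m arbitrary: n x)
  case (Suc m)
  show ?case
  proof (cases n)
    case (Suc k)
    have "(\<Sum>i<n. f ((T ^^ i) x)) = f x + (\<Sum>i<k. f ((T ^^ i) (T x)))"
      unfolding Suc sum.lessThan_Suc_shift by (simp add: funpow_swap1)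
    also have "\<dots> \<le> f x + max_birkhoff_sum T f m (T x)"
      using Suc.IH[of k "T x"] Suc.prems Suc by simp
    finally show ?thesis by simp
  qed simp
qed simp

lemma max_birkhoff_sum_mono: "max_birkhoff_sum T f m x \<le> max_birkhoff_sum T f (Suc m) x"
proof (induction m arbitrary: x)
  case (Suc m)
  from Suc[of "T x"] show ?case
    by (simp del: max_birkhoff_sum.simps add: max_birkhoff_sum.simps(2)[of T f _ x])
qed simp

lemma integrable_max_birkhoff_sum:
  assumes T: "T \<in> measurable M M" and distr: "distr M M T = M" and f: "integrable M f"
  shows "integrable M (max_birkhoff_sum T f m)"
proof (induction m)
  case (Suc m)
  have "integrable M (\<lambda>x. max_birkhoff_sum T f m (T x))"
    using Suc T by (intro integrable_distr[OF T]) (simp add: distr)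
  with f show ?case by (simp add: max_birkhoff_sum.simps(2)[abs_def])
qed simp

text \<open>Garsia's argument: where the maximum \<open>g\<close> is positive, \<open>g \<le> f + g \<circ> T\<close>; elsewhere
  \<open>g = 0 \<le> g \<circ> T\<close>.\<close>

lemma maximal_ergodic:
  assumes T: "T \<in> measurable M M" and distr: "distr M M T = M" and f: "integrable M f"
  shows "0 \<le> (\<integral>x. f x * indicator {x\<in>space M. 0 < max_birkhoff_sum T f m x} x \<partial>M)"
proof (cases m)
  case (Suc k)
  let ?g = "max_birkhoff_sum T f m"
  let ?E = "{x\<in>space M. 0 < ?g x}"
  have g: "integrable M ?g" by (rule integrable_max_birkhoff_sum[OF assms])
  have [measurable]: "?g \<in> borel_measurable M" using g by (rule borel_measurable_integrable)
  have gT: "integrable M (\<lambda>x. ?g (T x))"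
    using g T by (intro integrable_distr[OF T]) (simp add: distr)
  \<comment> \<open>T preserves M, so g and its composition with T have the same, finite,
    integral.\<close>
  have "0 = (\<integral>x. ?g x \<partial>M) - (\<integral>x. ?g (T x) \<partial>M)"
    using integral_distr[OF T, of ?g] by (simp add: distr)
  also have "\<dots> = (\<integral>x. ?g x - ?g (T x) \<partial>M)"
    using g gT by simp
  also have "\<dots> \<le> (\<integral>x. f x * indicator ?E x \<partial>M)"
  proof (rule integral_mono)
    show "integrable M (\<lambda>x. f x * indicator ?E x)"
      using integrable_mult_indicator[of ?E M f] f by (simp add: mult.commute)
    fix x assume x: "x \<in> space M"
    show "?g x - ?g (T x) \<le> f x * indicator ?E x"
    proof (cases "0 < ?g x")
      case True
      then have "?g x = f x + max_birkhoff_sum T f k (T x)" by (simp add: Suc)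
      \<comment> \<open>The maximum up to k is replaced by the larger one up to k + 1 = m, so that
        the same g stands on both sides.\<close>
      then have "?g x \<le> f x + ?g (T x)"
        using max_birkhoff_sum_mono[of T f k "T x"] unfolding Suc by linarith
      then show ?thesis using True x by simp
    next
      case False
      then show ?thesis using max_birkhoff_sum_nonneg[of T f m "T x"] by simp
    qed
  qed (use g gT in simp)
  finally show ?thesis .
qed simp

text \<open>Garsia's inequality is applied to f - c: where some sum of f - c is positive, the
  integral of f is at least c times the probability, and f \<ge> 0 bounds it by the full integral.
  The sets \<open>E m\<close> look at n \<le> m only and increase to a set that contains the
  event.\<close>

lemma (in prob_space) maximal_ergodic_prob:
  assumes T: "T \<in> measurable M M" and distr: "distr M M T = M"
    and f: "integrable M f" and nn: "\<And>x. 0 \<le> f x" and c: "0 < c"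
  shows "prob {x\<in>space M. \<exists>n. c * real n < (\<Sum>i<n. f ((T ^^ i) x))} \<le> (\<integral>x. f x \<partial>M) / c"
proof -
  let ?h = "\<lambda>x. f x - c"
  define E where "E m = {x\<in>space M. 0 < max_birkhoff_sum T ?h m x}" for m
  have h: "integrable M ?h" using f by simp
  have E[measurable]: "E m \<in> sets M" for m
    using borel_measurable_integrable[OF integrable_max_birkhoff_sum[OF T distr h, of m]]
    unfolding E_def by measurable
  have "prob (E m) \<le> (\<integral>x. f x \<partial>M) / c" for m
  proof -
    have fE: "integrable M (\<lambda>x. f x * indicator (E m) x)"
      using integrable_mult_indicator[OF E f, of m] by (simp add: mult.commute)
    have cE: "integrable M (\<lambda>x. c * indicator (E m) x)"
      using E by (simp add: emeasure_eq_measure)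
    have "0 \<le> (\<integral>x. ?h x * indicator (E m) x \<partial>M)"
      unfolding E_def by (rule maximal_ergodic[OF T distr h])
    also have "\<dots> = (\<integral>x. f x * indicator (E m) x \<partial>M) - c * prob (E m)"
      using fE cE sets.sets_into_space[OF E, of m] by (simp add: left_diff_distrib Int_absorb2)
    also have "(\<integral>x. f x * indicator (E m) x \<partial>M) \<le> (\<integral>x. f x \<partial>M)"
      using fE f nn by (intro integral_mono) (auto simp: indicator_def)
    finally show ?thesis using c by (simp add: field_simps)
  qed
  moreover have "incseq E"
  proof (intro incseq_SucI subsetI)
    fix m x assume "x \<in> E m"
    then show "x \<in> E (Suc m)"
      using max_birkhoff_sum_mono[of T ?h m x]
      by (simp add: E_def del: max_birkhoff_sum.simps)
  qed
  then have "(\<lambda>m. prob (E m)) \<longlonglongrightarrow> prob (\<Union>m. E m)"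
    by (intro finite_Lim_measure_incseq) auto
  ultimately have "prob (\<Union>m. E m) \<le> (\<integral>x. f x \<partial>M) / c"
    by (intro LIMSEQ_le_const2) auto
  moreover have "{x\<in>space M. \<exists>n. c * real n < (\<Sum>i<n. f ((T ^^ i) x))} \<subseteq> (\<Union>m. E m)"
  proof safe
    fix x n assume x: "x \<in> space M" and "c * real n < (\<Sum>i<n. f ((T ^^ i) x))"
    then have "0 < (\<Sum>i<n. ?h ((T ^^ i) x))" by (simp add: sum_subtractf mult.commute)
    also have "\<dots> \<le> max_birkhoff_sum T ?h n x" by (rule birkhoff_sum_le_max) simp
    finally show "x \<in> (\<Union>m. E m)" using x by (auto simp: E_def)
  qed
  then have "prob {x\<in>space M. \<exists>n. c * real n < (\<Sum>i<n. f ((T ^^ i) x))} \<le> prob (\<Union>m. E m)"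
    by (intro finite_measure_mono) auto
  ultimately show ?thesis by linarith
qed

text \<open>The averages have the form used in \<open>frequently_close\<close>, which allows a
  termwise comparison.\<close>

definition upper_freq :: "'a set \<Rightarrow> (nat \<Rightarrow> 'a) \<Rightarrow> ereal" where
  "upper_freq G \<omega> = limsup (\<lambda>n. ereal (1 / real n * (\<Sum>i<n. indicator G (\<omega> i))))"

lemma borel_measurable_upper_freq:
  assumes [measurable]: "G \<in> sets N"
  shows "upper_freq G \<in> borel_measurable (path_space N)"
  unfolding upper_freq_def[abs_def] by measurable

text \<open>The two sums differ by
  \<open>indicator G (\<omega> n) - indicator G (\<omega> 0)\<close>, at most 1 in absolute value,
  and this vanishes after division by n.\<close>

lemma upper_freq_shift: "upper_freq G (\<lambda>i. \<omega> (Suc i)) = upper_freq G \<omega>"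
proof -
  define d where "d n = 1 / real n * (indicator G (\<omega> n) - indicator G (\<omega> 0))" for n
  have "d \<longlonglongrightarrow> 0"
  proof (rule tendsto_rabs_zero_cancel, rule tendsto_sandwich[of "\<lambda>_. 0" _ _ "\<lambda>n. 1 / real n"])
    show "(\<lambda>n. 1 / real n) \<longlonglongrightarrow> 0" by (rule lim_1_over_n)
  qed (auto simp: d_def indicator_def intro!: always_eventually)
  then have "(\<lambda>n. ereal (d n)) \<longlonglongrightarrow> 0" by (simp add: zero_ereal_def)
  from ereal_limsup_lim_add[OF this, of "\<lambda>n. ereal (1 / real n * (\<Sum>i<n. indicator G (\<omega> i)))"]
  have "limsup (\<lambda>n. ereal (d n) + ereal (1 / real n * (\<Sum>i<n. indicator G (\<omega> i)))) = upper_freq G \<omega>"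
    by (simp add: upper_freq_def)
  moreover have "d n + 1 / real n * (\<Sum>i<n. indicator G (\<omega> i)) = 1 / real n * (\<Sum>i<n. indicator G (\<omega> (Suc i)))" for n
  proof -
    have "(\<Sum>i<n. indicator G (\<omega> (Suc i)) :: real) = (\<Sum>i<n. indicator G (\<omega> i)) + indicator G (\<omega> n) - indicator G (\<omega> 0)"
      by (induction n) auto
    then show ?thesis unfolding d_def distrib_left[symmetric] by simp
  qed
  ultimately show ?thesis by (simp add: upper_freq_def)
qed

section \<open>Upper frequencies under the stationary law\<close>

context stationary_chain
begin

text \<open>If the limsup is at least c, some average exceeds c / 2, and the maximal inequality at
  level c / 2 produces the factor 2. The slack is there because averages with limsup c may all stay
  below c.\<close>

lemma prob_upper_freq_ge:
  assumes G: "G \<in> sets N" and c: "0 < c"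
  shows "Q.prob {\<omega>\<in>space S. ereal c \<le> upper_freq G \<omega>} \<le> 2 * prob G / c"
proof -
  let ?T = "\<lambda>\<omega> i. \<omega> (Suc i) :: 'a" and ?f = "\<lambda>\<omega>. indicator G (\<omega> 0 :: 'a) :: real"
  have T: "?T \<in> measurable Q Q"
    using measurable_shift[of "Suc 0" N] by (simp add: measurable_cong_sets[OF sets_Q sets_Q])
  have d: "distr Q Q ?T = Q"
    using distr_shift by (simp add: distr_cong[OF refl sets_Q])
  have Tn: "(?T ^^ n) \<omega> j = \<omega> (n + j)" for n \<omega> j
    by (induction n arbitrary: j) auto
  have fm: "?f \<in> borel_measurable Q"
    using measurable_compose[OF measurable_coordinate borel_measurable_indicator[OF G]] .
  have f: "integrable Q ?f"
    using fm by (intro Q.integrable_const_bound[of _ 1]) auto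
  have "(\<integral>\<omega>. ?f \<omega> \<partial>Q) = (\<integral>x. indicator G x \<partial>distr Q N (\<lambda>\<omega>. \<omega> 0))"
    using G by (intro integral_distr[symmetric] measurable_coordinate) simp
  also have "\<dots> = prob G"
    using G sets.sets_into_space[OF G] by (simp add: distr_coordinate sets_\<mu> space_\<mu> Int_absorb2)
  finally have "Q.prob {\<omega>\<in>space Q. \<exists>n. (c / 2) * real n < (\<Sum>i<n. ?f ((?T ^^ i) \<omega>))} \<le> prob G / (c / 2)"
    using Q.maximal_ergodic_prob[OF T d f _, of "c / 2"] c by simp
  moreover have "{\<omega>\<in>space S. ereal c \<le> upper_freq G \<omega>} \<subseteq> {\<omega>\<in>space Q. \<exists>n. (c / 2) * real n < (\<Sum>i<n. ?f ((?T ^^ i) \<omega>))}"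
  proof
    fix \<omega> assume "\<omega> \<in> {\<omega>\<in>space S. ereal c \<le> upper_freq G \<omega>}"
    then have \<omega>: "\<omega> \<in> space S" and "ereal c \<le> upper_freq G \<omega>" by simp_all
    then have "ereal (c / 2) < upper_freq G \<omega>"
      using c less_le_trans[of "ereal (c / 2)" "ereal c" "upper_freq G \<omega>"] by simp
    then have "\<not> (\<forall>n. ereal (1 / real n * (\<Sum>i<n. indicator G (\<omega> i))) \<le> ereal (c / 2))"
      using Limsup_bounded[OF always_eventually, of "\<lambda>n. ereal (1 / real n * (\<Sum>i<n. indicator G (\<omega> i)))" "ereal (c / 2)" sequentially]
      unfolding upper_freq_def by (simp only: not_le[symmetric]) blast
    then obtain n where n: "c / 2 < 1 / real n * (\<Sum>i<n. indicator G (\<omega> i))" by (auto simp: not_le)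
    \<comment> \<open>The average at n = 0 is 0, as 1 / 0 = 0, and cannot exceed c / 2; so
      multiplying by n is harmless.\<close>
    then have "n \<noteq> 0" using c by (cases n) auto
    then have "(c / 2) * real n < (\<Sum>i<n. ?f ((?T ^^ i) \<omega>))"
      using n by (simp add: Tn field_simps)
    with \<omega> show "\<omega> \<in> {\<omega>\<in>space Q. \<exists>n. (c / 2) * real n < (\<Sum>i<n. ?f ((?T ^^ i) \<omega>))}"
      by (simp only: space_Q mem_Collect_eq) blast
  qed
  then have "Q.prob {\<omega>\<in>space S. ereal c \<le> upper_freq G \<omega>} \<le>
      Q.prob {\<omega>\<in>space Q. \<exists>n. (c / 2) * real n < (\<Sum>i<n. ?f ((?T ^^ i) \<omega>))}"
  proof (rule Q.finite_measure_mono)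
    show "{\<omega>\<in>space Q. \<exists>n. (c / 2) * real n < (\<Sum>i<n. ?f ((?T ^^ i) \<omega>))} \<in> sets Q"
      using measurable_compose[OF measurable_coordinate borel_measurable_indicator[OF G, where 'b=real]]
      unfolding Tn by measurable
  qed
  ultimately show ?thesis by (simp add: mult.commute)
qed

text \<open>One exceptional null set has to serve all c, so the claim is shown for c = 1 / (j + 1)
  and the countably many null sets are united. The bound (1 / 2)^k on \<open>G k\<close> makes the
  probabilities of bad starting points summable.\<close>

lemma AE_upper_freq_less:
  assumes G: "\<And>k. G k \<in> sets N" and small: "\<And>k. prob (G k) \<le> (1 / 2) ^ k"
  shows "AE x in \<mu>. \<forall>c>0. \<forall>\<^sub>F k in sequentially. AE \<omega> in L x. upper_freq (G k) \<omega> < ereal c"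
proof -
  have "AE x in \<mu>. \<forall>\<^sub>F k in sequentially. AE \<omega> in L x. upper_freq (G k) \<omega> < ereal (1 / real (Suc j))" for j
  proof -
    define c where "c = 1 / real (Suc j)"
    have c: "0 < c" by (simp add: c_def)
    define D where "D k = {\<omega>\<in>space S. ereal c \<le> upper_freq (G k) \<omega>}" for k
    have D: "D k \<in> sets S" for k
      using borel_measurable_upper_freq[OF G[of k]] unfolding D_def by measurable
    \<comment> \<open>By the zero-one law the bad event has probability 1 from almost every point of
      \<open>E k\<close>, so \<mu>(E k) = Q(D k); in general only \<mu>(E k) \<ge> Q(D k) would
      hold, which is of no use for an upper bound.\<close>
    define E where "E k = {x\<in>space \<mu>. emeasure (L x) (D k) \<noteq> 0}" for k
    have Em: "E k \<in> sets \<mu>" for k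
      using emeasure_L_measurable[OF D[of k]] unfolding E_def measurable_cong_sets[OF sets_\<mu>[symmetric] refl] by measurable
    have PE: "prob (E k) \<le> 2 / c * (1 / 2) ^ k" for k
    proof -
      have "(\<lambda>i. \<omega> (Suc i)) \<in> D k \<longleftrightarrow> \<omega> \<in> D k" if "\<omega> \<in> space S" for \<omega>
        using that by (auto simp: D_def upper_freq_shift space_PiM)
      from AE_invariant_zero_one[OF D this]
      have "(\<integral>\<^sup>+x. indicator (E k) x \<partial>\<mu>) = (\<integral>\<^sup>+x. emeasure (L x) (D k) \<partial>\<mu>)"
        by (intro nn_integral_cong_AE) (auto simp: E_def indicator_def)
      then have "emeasure \<mu> (E k) = emeasure Q (D k)"
        using Em by (simp add: emeasure_Q[OF D])
      then have "prob (E k) = Q.prob (D k)"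
        by (simp add: measure_def)
      also have "\<dots> \<le> 2 * prob (G k) / c"
        unfolding D_def by (rule prob_upper_freq_ge[OF G c])
      also have "\<dots> \<le> 2 / c * (1 / 2) ^ k"
        using small[of k] c by (simp add: field_simps)
      finally show ?thesis .
    qed
    have "summable (\<lambda>k. 2 / c * (1 / 2 :: real) ^ k)"
      by (intro summable_mult summable_geometric) simp
    then have "summable (\<lambda>k. prob (E k))"
      by (rule summable_comparison_test'[where N=0]) (simp only: real_norm_def abs_of_nonneg measure_nonneg PE)
    from borel_cantelli_AE1[OF Em _ this]
    have "AE x in \<mu>. \<forall>\<^sub>F k in sequentially. x \<in> space \<mu> - E k"
      by (simp add: emeasure_eq_measure)
    then show ?thesis
    proof (rule AE_mp, intro AE_I2 impI)
      fix x assume x: "x \<in> space \<mu>" and "\<forall>\<^sub>F k in sequentially. x \<in> space \<mu> - E k"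
      then show "\<forall>\<^sub>F k in sequentially. AE \<omega> in L x. upper_freq (G k) \<omega> < ereal (1 / real (Suc j))"
      proof (elim eventually_mono)
        fix k assume "x \<in> space \<mu> - E k"
        then have "emeasure (L x) (D k) = 0" by (simp add: E_def)
        moreover have s: "sets (L x) = sets S" using x by (intro sets_chain_law[OF ker]) (simp add: space_\<mu>)
        ultimately show "AE \<omega> in L x. upper_freq (G k) \<omega> < ereal (1 / real (Suc j))"
          using D[of k] sets_eq_imp_space_eq[OF s]
          by (intro AE_I[of _ _ "D k"]) (auto simp: D_def c_def not_less)
      qed
    qed
  qed
  then have "AE x in \<mu>. \<forall>j. \<forall>\<^sub>F k in sequentially. AE \<omega> in L x. upper_freq (G k) \<omega> < ereal (1 / real (Suc j))"
    by (simp add: AE_all_countable)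
  then show ?thesis
  proof (rule AE_mp, intro AE_I2 impI allI)
    fix x and c :: real assume *: "\<forall>j. \<forall>\<^sub>F k in sequentially. AE \<omega> in L x. upper_freq (G k) \<omega> < ereal (1 / real (Suc j))"
      and "0 < c"
    obtain j where "1 / real (Suc j) < c"
      using nat_approx_posE[OF \<open>0 < c\<close>] by blast
    then show "\<forall>\<^sub>F k in sequentially. AE \<omega> in L x. upper_freq (G k) \<omega> < ereal c"
      using *[rule_format, of j]
      by (elim eventually_mono AE_mp) (auto intro!: AE_I2 elim: less_trans)
  qed
qed

end

section \<open>Closed regularity and tightness\<close>

text \<open>The sets that can be squeezed between a closed and an open set up to every e > 0 form a
  sigma-algebra containing the open sets. The two-sided form makes complements work: they swap the
  roles of F and U.\<close>

lemma closed_open_regular: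
  fixes A :: "'a::metric_space set"
  assumes "finite_measure M" and M: "sets M = sets borel" and A: "A \<in> sets borel" and "0 < e"
  shows "\<exists>F U. closed F \<and> open U \<and> F \<subseteq> A \<and> A \<subseteq> U \<and> measure M (U - F) < e"
proof -
  interpret finite_measure M by fact
  have [simp]: "space M = UNIV" using sets_eq_imp_space_eq[OF M] by simp
  have B[simp]: "A \<in> sets M" if "A \<in> sets borel" for A using that by (simp add: M)
  have "A \<in> sigma_sets UNIV {S. open S}"
    using A by (simp add: borel_def)
  then show ?thesis
    using \<open>0 < e\<close>
  proof (induction arbitrary: e)
    case (Basic A)
    then have A: "open A" by simp
    show ?case
    proof (cases "A = UNIV")
      case True
      then show ?thesis using Basic by (intro exI[of _ UNIV]) auto
    next
      case False
      \<comment> \<open>\<open>infdist\<close> to the empty set is 0, which would make these sets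
        empty for A = UNIV; hence the separate case. Otherwise the distance to - A is positive
        exactly on A.\<close>
      define F where "F n = {x. 1 / real (Suc n) \<le> infdist x (- A)}" for n
      have F: "closed (F n)" for n
        unfolding F_def by (intro closed_Collect_le continuous_intros)
      have "incseq F"
        unfolding F_def by (intro incseq_SucI) (auto intro: order_trans[rotated] simp: frac_le)
      have "(\<Union>n. F n) = A"
      proof safe
        fix x n assume "x \<in> F n"
        then show "x \<in> A" by (rule_tac ccontr) (simp add: F_def)
      next
        fix x assume "x \<in> A"
        then have "0 < infdist x (- A)"
          using A False in_closed_iff_infdist_zero[of "- A" x] infdist_nonneg[of x "- A"] by force
        then obtain n where "1 / real (Suc n) < infdist x (- A)" by (rule nat_approx_posE)
        then show "x \<in> (\<Union>n. F n)" by (auto simp: F_def intro: less_imp_le)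
      qed
      moreover have "(\<lambda>n. measure M (F n)) \<longlonglongrightarrow> measure M (\<Union>n. F n)"
        using F \<open>incseq F\<close> by (intro finite_Lim_measure_incseq) auto
      ultimately have "\<forall>\<^sub>F n in sequentially. measure M A - e < measure M (F n)"
        using Basic by (intro order_tendstoD(1)) auto
      then obtain n where n: "measure M A - e < measure M (F n)"
        by (metis eventually_happens sequentially_bot)
      have "F n \<subseteq> A" using \<open>(\<Union>n. F n) = A\<close> by auto
      then have "measure M (A - F n) = measure M A - measure M (F n)"
        using A F[of n] by (intro finite_measure_Diff) auto
      then show ?thesis
        using n F[of n] A \<open>F n \<subseteq> A\<close> by (intro exI[of _ "F n"] exI[of _ A]) auto
    qed
  next
    case Empty
    then show ?case by (intro exI[of _ "{}"]) auto
  next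
    case (Compl A)
    obtain F U where "closed F" "open U" "F \<subseteq> A" "A \<subseteq> U" "measure M (U - F) < e"
      using Compl.IH[OF Compl.prems] by auto
    moreover have "- F - - U = U - F" by auto
    ultimately show ?case by (intro exI[of _ "- U"] exI[of _ "- F"]) auto
  next
    case (Union A)
    \<comment> \<open>Half of e is split geometrically among the gaps \<open>U i - F i\<close>. The
      other half pays for cutting the union of the \<open>F i\<close>, which may fail to be closed,
      down to a finite union.\<close>
    have "\<exists>F U. closed F \<and> open U \<and> F \<subseteq> A i \<and> A i \<subseteq> U \<and> measure M (U - F) < e / 2 * (1 / 2) ^ Suc i" for i
      using Union.prems by (intro Union.IH) auto
    then obtain F U where FU: "\<And>i. closed (F i)" "\<And>i. open (U i)" "\<And>i. F i \<subseteq> A i" "\<And>i. A i \<subseteq> U i"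
      "\<And>i. measure M (U i - F i) < e / 2 * (1 / 2) ^ Suc i"
      by metis
    have sums: "(\<lambda>i. e / 2 * (1 / 2) ^ Suc i) sums (e / 2)"
      using sums_mult[OF power_half_series, of "e / 2"] by simp
    have m: "F i \<in> sets M" "U i \<in> sets M" for i using FU by auto
    have sm: "summable (\<lambda>i. measure M (U i - F i))"
      using FU(5) by (intro summable_comparison_test'[OF sums_summable[OF sums]]) (simp add: less_imp_le)
    have "measure M ((\<Union>i. U i) - (\<Union>i. F i)) \<le> measure M (\<Union>i. U i - F i)"
      using m by (intro finite_measure_mono) auto
    also have "\<dots> \<le> (\<Sum>i. measure M (U i - F i))"
      using m sm by (intro finite_measure_subadditive_countably) auto
    also have "\<dots> \<le> e / 2"
      using suminf_le[OF less_imp_le[OF FU(5)] sm sums_summable[OF sums]] sums_unique[OF sums] by simp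
    finally have 1: "measure M ((\<Union>i. U i) - (\<Union>i. F i)) \<le> e / 2" .
    define G where "G n = (\<Union>i\<le>n. F i)" for n
    have G: "closed (G n)" for n unfolding G_def using FU(1) by auto
    then have Gm: "G n \<in> sets M" for n by simp
    have "incseq G" unfolding G_def by (intro incseq_SucI UN_mono) auto
    then have "(\<lambda>n. measure M (G n)) \<longlonglongrightarrow> measure M (\<Union>n. G n)"
      using G by (intro finite_Lim_measure_incseq) auto
    moreover have UG: "(\<Union>n. G n) = (\<Union>i. F i)" unfolding G_def by blast
    ultimately have "\<forall>\<^sub>F n in sequentially. measure M (\<Union>i. F i) - e / 2 < measure M (G n)"
      using Union.prems by (intro order_tendstoD(1)) auto
    then obtain n where n: "measure M (\<Union>i. F i) - e / 2 < measure M (G n)"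
      by (metis eventually_happens sequentially_bot)
    have 2: "measure M ((\<Union>i. F i) - G n) = measure M (\<Union>i. F i) - measure M (G n)"
      using G m UG by (intro finite_measure_Diff) auto
    have "measure M ((\<Union>i. U i) - G n) \<le> measure M (((\<Union>i. U i) - (\<Union>i. F i)) \<union> ((\<Union>i. F i) - G n))"
      using m Gm by (intro finite_measure_mono) auto
    also have "\<dots> \<le> measure M ((\<Union>i. U i) - (\<Union>i. F i)) + measure M ((\<Union>i. F i) - G n)"
      using m Gm by (intro measure_Un_le) auto
    also have "\<dots> < e" using 1 2 n by simp
    finally have "measure M ((\<Union>i. U i) - G n) < e" .
    moreover have "G n \<subseteq> (\<Union>i. A i)" using FU(3) by (auto simp: G_def)
    moreover have "(\<Union>i. A i) \<subseteq> (\<Union>i. U i)" using FU(4) by (intro UN_mono) auto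
    moreover have "open (\<Union>i. U i)" using FU(2) by auto
    ultimately show ?case
      using G[of n] by (intro exI[of _ "G n"] exI[of _ "\<Union>i. U i"] conjI)
  qed
qed

lemma exists_closed_inner:
  fixes A :: "'a::metric_space set"
  assumes "finite_measure M" and M: "sets M = sets borel" and A: "A \<in> sets borel" and "0 < e"
  obtains F where "closed F" "F \<subseteq> A" "measure M (A - F) < e"
proof -
  interpret finite_measure M by fact
  obtain F U where FU: "closed F" "open U" "F \<subseteq> A" "A \<subseteq> U" "measure M (U - F) < e"
    using closed_open_regular[OF assms] by blast
  then have "measure M (A - F) \<le> measure M (U - F)"
    using A by (intro finite_measure_mono) (auto simp: M)
  with FU that show thesis by auto
qed

text \<open>Ulam's argument. For each radius 1 / (n + 1), finitely many closed balls around a dense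
  sequence miss only a geometrically small part of the mass; the intersection K over n is closed and
  totally bounded, hence compact by completeness.\<close>

lemma exists_compact_inner:
  fixes M :: "'a::metric_space measure"
  assumes "finite_measure M" and M: "sets M = sets borel"
    and sep: "separable_space (euclidean :: 'a topology)"
    and cm: "completely_metrizable_space (euclidean :: 'a topology)" and "0 < e"
  obtains K :: "'a set" where "compact K" "measure M (- K) < e"
proof -
  interpret finite_measure M by fact
  have [simp]: "space M = UNIV" using sets_eq_imp_space_eq[OF M] by simp
  \<comment> \<open>The metric d is complete but may differ from \<open>dist\<close>. Balls are
    taken in d; that they are closed and that K is compact depends only on the common
    topology.\<close>
  obtain X d where Xd: "Metric_space X d" "Metric_space.mcomplete X d" "(euclidean :: 'a topology) = Metric_space.mtopology X d"
    using cm unfolding completely_metrizable_space_def by metis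
  interpret Metric_space X d by fact
  have X: "X = UNIV" using arg_cong[OF Xd(3), of topspace] by simp
  obtain C :: "'a set" where C: "countable C" "euclidean closure_of C = UNIV"
    using sep by (auto simp: separable_space_def)
  then have "C \<noteq> {}" by auto
  define c where "c = from_nat_into C"
  have c: "range c = C" using range_from_nat_into[OF \<open>C \<noteq> {}\<close> C(1)] by (simp add: c_def)
  define B where "B n k = (\<Union>i\<le>k. mcball (c i) (1 / real (Suc n)))" for n k :: nat
  have cc: "closed (mcball x r)" for x r
    using closedin_mcball[of x r] unfolding Xd(3)[symmetric] by simp
  then have Bc: "closed (B n k)" for n k
    unfolding B_def using cc by auto
  have "\<exists>k. measure M (- B n k) < e / 2 * (1 / 2) ^ Suc n" for n
  proof -
    have "(\<Union>k. B n k) = UNIV"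
    proof (intro equalityI subset_UNIV subsetI)
      fix x :: 'a
      have "x \<in> mtopology closure_of C" using C(2) Xd(3) by simp
      then obtain y where "y \<in> C" "y \<in> mball x (1 / real (Suc n))"
        by (auto simp: metric_closure_of dest!: spec[of _ "1 / real (Suc n)"])
      moreover from \<open>y \<in> C\<close> c obtain i where "y = c i" by blast
      ultimately have "x \<in> mcball (c i) (1 / real (Suc n))"
        unfolding in_mball in_mcball by (auto simp: commute)
      then show "x \<in> (\<Union>k. B n k)" by (auto simp: B_def)
    qed
    moreover have "incseq (B n)" unfolding B_def by (intro incseq_SucI UN_mono) auto
    then have "(\<lambda>k. measure M (B n k)) \<longlonglongrightarrow> measure M (\<Union>k. B n k)"
      using Bc by (intro finite_Lim_measure_incseq) (auto simp: M)
    ultimately have "\<forall>\<^sub>F k in sequentially. measure M UNIV - e / 2 * (1 / 2) ^ Suc n < measure M (B n k)"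
      using \<open>0 < e\<close> by (intro order_tendstoD(1)) auto
    then obtain k where "measure M UNIV - e / 2 * (1 / 2) ^ Suc n < measure M (B n k)"
      by (metis eventually_happens sequentially_bot)
    moreover have "measure M (- B n k) = measure M UNIV - measure M (B n k)"
      using finite_measure_compl[of "B n k"] Bc[of n k] by (simp add: M Compl_eq_Diff_UNIV)
    ultimately show ?thesis by (intro exI[of _ k]) simp
  qed
  then obtain k where k: "\<And>n. measure M (- B n (k n)) < e / 2 * (1 / 2) ^ Suc n" by metis
  define K where "K = (\<Inter>n. B n (k n))"
  have "closed K" unfolding K_def using Bc by auto
  have "mtotally_bounded K"
    unfolding mtotally_bounded_def
  proof (intro allI impI)
    fix r :: real assume "0 < r"
    \<comment> \<open>Total boundedness asks for centres in K, so each \<open>c i\<close> whose ball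
      meets K is replaced by a point \<open>p i\<close> of K in that ball. This doubles the radius,
      hence r / 2.\<close>
    then obtain n where n: "1 / real (Suc n) < r / 2" using nat_approx_posE[of "r / 2"] by auto
    define I where "I = {i. i \<le> k n \<and> K \<inter> mcball (c i) (1 / real (Suc n)) \<noteq> {}}"
    have "\<forall>i\<in>I. \<exists>y. y \<in> K \<inter> mcball (c i) (1 / real (Suc n))" by (auto simp: I_def)
    then obtain p where p: "\<And>i. i \<in> I \<Longrightarrow> p i \<in> K" "\<And>i. i \<in> I \<Longrightarrow> p i \<in> mcball (c i) (1 / real (Suc n))"
      by (metis IntD1 IntD2)
    have "K \<subseteq> (\<Union>x\<in>p ` I. mball x r)"
    proof
      fix x assume "x \<in> K"
      then obtain i where i: "i \<le> k n" "x \<in> mcball (c i) (1 / real (Suc n))" by (auto simp: K_def B_def)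
      with \<open>x \<in> K\<close> have "i \<in> I" by (auto simp: I_def)
      have "d (p i) x \<le> d (p i) (c i) + d (c i) x"
        by (rule triangle) (simp_all add: X)
      also have "\<dots> \<le> 1 / real (Suc n) + 1 / real (Suc n)"
        using i(2) p(2)[OF \<open>i \<in> I\<close>] unfolding in_mcball by (intro add_mono) (simp_all add: commute)
      also have "\<dots> < r" using n by simp
      finally have "x \<in> mball (p i) r" unfolding in_mball by (simp add: X)
      with \<open>i \<in> I\<close> show "x \<in> (\<Union>x\<in>p ` I. mball x r)" by auto
    qed
    moreover have "finite I" unfolding I_def by (rule finite_subset[of _ "{..k n}"]) auto
    ultimately show "\<exists>F. finite F \<and> F \<subseteq> K \<and> K \<subseteq> (\<Union>x\<in>F. mball x r)"
      using p(1) by (intro exI[of _ "p ` I"]) auto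
  qed
  then have "compactin mtopology (mtopology closure_of K)"
    using mtotally_bounded_eq_compact_closure_of[OF Xd(2)] by blast
  moreover have "mtopology closure_of K = K"
    using \<open>closed K\<close> unfolding Xd(3)[symmetric] by (simp add: closure_of_eq)
  ultimately have "compact K" unfolding Xd(3)[symmetric] by simp
  have sums: "(\<lambda>i. e / 2 * (1 / 2) ^ Suc i) sums (e / 2)"
    using sums_mult[OF power_half_series, of "e / 2"] by simp
  have sm: "summable (\<lambda>i. measure M (- B i (k i)))"
    using k by (intro summable_comparison_test'[OF sums_summable[OF sums]]) (simp add: less_imp_le)
  have "measure M (- K) = measure M (\<Union>n. - B n (k n))" by (simp add: K_def)
  also have "\<dots> \<le> (\<Sum>n. measure M (- B n (k n)))"
    using Bc sm by (intro finite_measure_subadditive_countably) (auto simp: M)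
  also have "\<dots> \<le> e / 2"
    using suminf_le[OF less_imp_le[OF k] sm sums_summable[OF sums]] sums_unique[OF sums] by simp
  finally have "measure M (- K) < e" using \<open>0 < e\<close> by simp
  with \<open>compact K\<close> that show thesis by blast
qed

text \<open>The sets where f exceeds 1 / (n + 1) are open, increase with n and cover K, so by
  compactness one of them contains K.\<close>

lemma lower_semicontinuous_pos_bounded_below:
  fixes f :: "'a::topological_space \<Rightarrow> real"
  assumes f: "lower_semicontinuous f" and K: "compact K" and pos: "\<And>z. z \<in> K \<Longrightarrow> 0 < f z"
  obtains \<eta> where "0 < \<eta>" "\<And>z. z \<in> K \<Longrightarrow> \<eta> \<le> f z"
proof -
  let ?U = "\<lambda>n. {z. 1 / real (Suc n) < f z}"
  have o: "open {z. c < f z}" for c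
  proof (subst open_subopen, intro ballI)
    fix z assume "z \<in> {z. c < f z}"
    then have "\<forall>\<^sub>F w in nhds z. c < f w" using f by (auto simp: lower_semicontinuous_def)
    then show "\<exists>T. open T \<and> z \<in> T \<and> T \<subseteq> {z. c < f z}" unfolding eventually_nhds by auto
  qed
  have cov: "K \<subseteq> (\<Union>n. ?U n)"
  proof
    fix z assume "z \<in> K"
    then obtain n where "1 / real (Suc n) < f z" by (rule nat_approx_posE[OF pos])
    then show "z \<in> (\<Union>n. {z. 1 / real (Suc n) < f z})" by blast
  qed
  obtain N where N: "N \<subseteq> UNIV" "finite N" "K \<subseteq> (\<Union>n\<in>N. ?U n)"
    using compactE_image[OF K, of UNIV ?U, OF o cov] by metis
  obtain m where m: "N \<subseteq> {..m}" using \<open>finite N\<close> finite_nat_iff_bounded_le by blast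
  have "1 / real (Suc m) \<le> f z" if z: "z \<in> K" for z
  proof -
    obtain n where "n \<in> N" "1 / real (Suc n) < f z" using subsetD[OF N(3) z] by (elim UN_E CollectE)
    moreover have "1 / real (Suc m) \<le> 1 / real (Suc n)" using m \<open>n \<in> N\<close> by (auto simp: frac_le)
    ultimately show ?thesis by linarith
  qed
  with that[of "1 / real (Suc m)"] show thesis by simp
qed

section \<open>Separated sets and couplings\<close>

lemma AE_pair_measure_fst_snd:
  assumes "prob_space M1" "prob_space M2" and P: "AE x in M1. P x" and R: "AE y in M2. R y"
  shows "AE z in M1 \<Otimes>\<^sub>M M2. P (fst z) \<and> R (snd z)"
proof -
  interpret M1: prob_space M1 by fact
  interpret M2: prob_space M2 by fact
  obtain A where A: "{x\<in>space M1. \<not> P x} \<subseteq> A" "A \<in> null_sets M1"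
    using P by (auto elim!: AE_E simp: null_sets_def)
  obtain B where B: "{y\<in>space M2. \<not> R y} \<subseteq> B" "B \<in> null_sets M2"
    using R by (auto elim!: AE_E simp: null_sets_def)
  have "A \<times> space M2 \<in> null_sets (M1 \<Otimes>\<^sub>M M2)" "space M1 \<times> B \<in> null_sets (M1 \<Otimes>\<^sub>M M2)"
    using A(2) B(2) by (auto simp: null_sets_def M2.emeasure_pair_measure_Times)
  then have "A \<times> space M2 \<union> space M1 \<times> B \<in> null_sets (M1 \<Otimes>\<^sub>M M2)" by auto
  then show ?thesis
    by (rule AE_I') (use A(1) B(1) in \<open>auto simp: space_pair_measure\<close>)
qed

text \<open>The entry point of absolute continuity: a null set of L1 or L2 stays null under the
  corresponding marginal, so almost sure properties of the two single paths hold jointly under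
  \<xi>.\<close>

lemma gen_coupling_AE:
  assumes \<xi>: "\<xi> \<in> gen_couplings L1 L2" and P: "AE \<omega> in L1. P \<omega>" and R: "AE \<omega> in L2. R \<omega>"
  shows "AE z in \<xi>. P (fst z) \<and> R (snd z)"
proof -
  have s: "sets \<xi> = sets (L1 \<Otimes>\<^sub>M L2)"
    and ac: "absolutely_continuous L1 (distr \<xi> L1 fst)" "absolutely_continuous L2 (distr \<xi> L2 snd)"
    using \<xi> by (simp_all add: gen_couplings_def)
  have m: "fst \<in> measurable \<xi> L1" "snd \<in> measurable \<xi> L2"
    by (simp_all add: measurable_cong_sets[OF s refl])
  have "AE \<omega> in distr \<xi> L1 fst. P \<omega>" "AE \<omega> in distr \<xi> L2 snd. R \<omega>"
    by (rule absolutely_continuous_AE[OF _ ac(1) P], simp)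
      (rule absolutely_continuous_AE[OF _ ac(2) R], simp)
  then have "AE z in \<xi>. P (fst z)" "AE z in \<xi>. R (snd z)"
    using AE_distrD[OF m(1)] AE_distrD[OF m(2)] by blast+
  then show ?thesis by (rule AE_conjI)
qed

lemma stationary_chainI:
  assumes "markov_kernel N P" "invariant_prob N P \<mu>"
  shows "stationary_chain \<mu> N P"
proof -
  interpret prob_space \<mu> using assms(2) by (simp add: invariant_prob_def)
  show ?thesis using assms by unfold_locales (auto simp: invariant_prob_def)
qed

text \<open>The common core of both parts: \<open>dist\<close> and \<rho> differ only in how the
  sets asked for by \<open>sep\<close> are found. The bound \<eta> may shrink with e.\<close>

lemma not_coupling_condition:
  fixes P :: "'a::topological_space \<Rightarrow> 'a measure"
  assumes ker: "markov_kernel borel P" and inv: "invariant_prob borel P \<mu>1" "invariant_prob borel P \<mu>2"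
    and sep: "\<And>e. 0 < e \<Longrightarrow> \<exists>F1\<in>sets borel. \<exists>F2\<in>sets borel. \<exists>\<eta>>0.
        measure \<mu>1 (- F1) \<le> e \<and> measure \<mu>2 (- F2) \<le> e \<and> (\<forall>a\<in>F1. \<forall>b\<in>F2. \<eta> \<le> \<delta> a b)"
  shows "\<not> coupling_condition \<delta> P \<mu>1 \<mu>2"
proof
  assume "coupling_condition \<delta> P \<mu>1 \<mu>2"
  then obtain M where M: "M \<in> sets (borel \<Otimes>\<^sub>M borel)" "emeasure (\<mu>1 \<Otimes>\<^sub>M \<mu>2) M > 0"
    and cpl: "\<forall>(x, y)\<in>M. \<exists>\<alpha>>0. \<forall>\<epsilon>>0. \<exists>\<xi>\<in>gen_couplings (chain_law borel P x) (chain_law borel P y).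
             outer_measure_of \<xi> (frequently_close \<delta> \<epsilon> \<alpha>) > 0"
    unfolding coupling_condition_def by (elim bexE conjE)
  interpret m1: stationary_chain \<mu>1 borel P by (rule stationary_chainI[OF ker inv(1)])
  interpret m2: stationary_chain \<mu>2 borel P by (rule stationary_chainI[OF ker inv(2)])
  have "\<exists>F1 F2 \<eta>. F1 \<in> sets borel \<and> F2 \<in> sets borel \<and> 0 < \<eta> \<and>
      measure \<mu>1 (- F1) \<le> (1 / 2) ^ k \<and> measure \<mu>2 (- F2) \<le> (1 / 2) ^ k \<and> (\<forall>a\<in>F1. \<forall>b\<in>F2. \<eta> \<le> \<delta> a b)" for k :: nat
    using sep[of "(1 / 2) ^ k"] by (auto simp del: power_one_over)
  then obtain F1 F2 \<eta> where F: "\<And>k. F1 k \<in> sets borel" "\<And>k. F2 k \<in> sets borel" "\<And>k. 0 < \<eta> k"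
      "\<And>k. measure \<mu>1 (- F1 k) \<le> (1 / 2) ^ k" "\<And>k. measure \<mu>2 (- F2 k) \<le> (1 / 2) ^ k"
      "\<And>k a b. a \<in> F1 k \<Longrightarrow> b \<in> F2 k \<Longrightarrow> \<eta> k \<le> \<delta> a b"
    by metis
  let ?L = "chain_law borel P"
  \<comment> \<open>All levels c are included, because \<alpha> becomes known only after a point of
    M has been picked.\<close>
  define good where "good F x \<longleftrightarrow> (\<forall>c>0. \<forall>\<^sub>F k in sequentially. AE \<omega> in ?L x. upper_freq (- F k) \<omega> < ereal c)"
    for F :: "nat \<Rightarrow> 'a set" and x
  have "AE x in \<mu>1. good F1 x" "AE x in \<mu>2. good F2 x"
    unfolding good_def using F by (auto intro!: m1.AE_upper_freq_less m2.AE_upper_freq_less borel_comp)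
  then have AE: "AE z in \<mu>1 \<Otimes>\<^sub>M \<mu>2. good F1 (fst z) \<and> good F2 (snd z)"
    by (intro AE_pair_measure_fst_snd m1.prob_space_axioms m2.prob_space_axioms)
  have "\<exists>z\<in>M. good F1 (fst z) \<and> good F2 (snd z)"
  proof (rule ccontr)
    assume no: "\<not> (\<exists>z\<in>M. good F1 (fst z) \<and> good F2 (snd z))"
    have "AE z in \<mu>1 \<Otimes>\<^sub>M \<mu>2. z \<notin> M"
      by (rule eventually_mono[OF AE]) (use no in blast)
    moreover have "M \<in> sets (\<mu>1 \<Otimes>\<^sub>M \<mu>2)"
      using M(1) sets_pair_measure_cong[OF m1.sets_\<mu> m2.sets_\<mu>] by simp
    ultimately show False using M(2) by (simp add: AE_iff_null_sets[symmetric] null_setsD1)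
  qed
  then obtain x y where xy: "(x, y) \<in> M" "good F1 x" "good F2 y" by auto
  obtain \<alpha> where \<alpha>: "0 < \<alpha>" "\<forall>\<epsilon>>0. \<exists>\<xi>\<in>gen_couplings (?L x) (?L y). outer_measure_of \<xi> (frequently_close \<delta> \<epsilon> \<alpha>) > 0"
    using cpl xy(1) by blast
  \<comment> \<open>With a third of \<alpha> for each path, the two frequencies add up to at most
    2\<alpha>/3, strictly below \<alpha>.\<close>
  have "0 < \<alpha> / 3" using \<alpha>(1) by simp
  then have "\<forall>\<^sub>F k in sequentially. (AE \<omega> in ?L x. upper_freq (- F1 k) \<omega> < ereal (\<alpha> / 3)) \<and>
      (AE \<omega> in ?L y. upper_freq (- F2 k) \<omega> < ereal (\<alpha> / 3))"
    using xy(2,3) unfolding good_def by (intro eventually_conj) blast+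
  from eventually_happens[OF this]
  obtain k where k: "AE \<omega> in ?L x. upper_freq (- F1 k) \<omega> < ereal (\<alpha> / 3)"
      "AE \<omega> in ?L y. upper_freq (- F2 k) \<omega> < ereal (\<alpha> / 3)"
    by auto
  \<comment> \<open>Now \<epsilon> is chosen as half of \<open>\<eta> k\<close>: on the product of
    \<open>F1 k\<close> and \<open>F2 k\<close> the value of \<delta> lies above it, so a close pair
    has a point outside one of the two sets.\<close>
  have "0 < \<eta> k / 2" using F(3)[of k] by simp
  then obtain \<xi> where \<xi>: "\<xi> \<in> gen_couplings (?L x) (?L y)"
      "outer_measure_of \<xi> (frequently_close \<delta> (\<eta> k / 2) \<alpha>) > 0"
    using \<alpha>(2) by blast
  let ?C = "frequently_close \<delta> (\<eta> k / 2) \<alpha>"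
  have notC: "z \<notin> ?C" if z: "upper_freq (- F1 k) (fst z) < ereal (\<alpha> / 3)" "upper_freq (- F2 k) (snd z) < ereal (\<alpha> / 3)" for z
  proof -
    let ?I = "\<lambda>G \<omega> n. ereal (1 / real n * (\<Sum>i<n. indicator G (\<omega> i)))"
    have le: "indicator {0..\<eta> k / 2} (\<delta> a b) \<le> (indicator (- F1 k) a + indicator (- F2 k) b :: real)" for a b
      using F(6)[of a k b] F(3)[of k] by (auto simp: indicator_def)
    have "ereal (1 / real n * (\<Sum>i<n. indicator {0..\<eta> k / 2} (\<delta> (fst z i) (snd z i)))) \<le>
        ?I (- F1 k) (fst z) n + ?I (- F2 k) (snd z) n" for n
    proof -
      have "(\<Sum>i<n. indicator {0..\<eta> k / 2} (\<delta> (fst z i) (snd z i)) :: real) \<le>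
          (\<Sum>i<n. indicator (- F1 k) (fst z i) + indicator (- F2 k) (snd z i))"
        by (rule sum_mono) (rule le)
      from mult_left_mono[OF this, of "1 / real n"] show ?thesis
        unfolding plus_ereal.simps ereal_less_eq distrib_left[symmetric] sum.distrib[symmetric] by simp
    qed
    then have "limsup (\<lambda>n. ereal (1 / real n * (\<Sum>i<n. indicator {0..\<eta> k / 2} (\<delta> (fst z i) (snd z i))))) \<le>
        limsup (\<lambda>n. ?I (- F1 k) (fst z) n + ?I (- F2 k) (snd z) n)"
      by (intro Limsup_mono always_eventually allI)
    also have "\<dots> \<le> upper_freq (- F1 k) (fst z) + upper_freq (- F2 k) (snd z)"
      unfolding upper_freq_def by (rule ereal_limsup_add_mono)
    also have "\<dots> \<le> ereal (\<alpha> / 3) + ereal (\<alpha> / 3)"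
      using z by (intro add_mono less_imp_le)
    also have "\<dots> < ereal \<alpha>" using \<alpha>(1) by simp
    finally show ?thesis by (simp add: frequently_close_def split_beta not_le)
  qed
  have "AE z in \<xi>. z \<notin> ?C"
    by (rule eventually_mono[OF gen_coupling_AE[OF \<xi>(1) k]]) (use notC in blast)
  \<comment> \<open>\<open>?C\<close> is not intersected with the space of \<xi>. A null set covers
    all of \<open>?C\<close>, as the outer measure demands, because that space contains every pair
    of paths.\<close>
  moreover have "space \<xi> = UNIV"
  proof -
    have "sets \<xi> = sets (path_space borel \<Otimes>\<^sub>M path_space borel)"
      using \<xi>(1) sets_pair_measure_cong[OF sets_chain_law[OF ker] sets_chain_law[OF ker], of x y]
      by (simp add: gen_couplings_def)
    from sets_eq_imp_space_eq[OF this] show ?thesis by (auto simp: space_pair_measure space_PiM)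
  qed
  ultimately obtain N where N: "?C \<subseteq> N" "N \<in> sets \<xi>" "emeasure \<xi> N = 0" by (auto elim!: AE_E)
  then have "outer_measure_of \<xi> ?C \<le> 0"
    using outer_measure_of_mono[OF N(1), of \<xi>] by simp
  with \<xi>(2) show False by simp
qed

text \<open>A set C that carries \<mu>1 and is null for \<mu>2 is approximated from inside with
  respect to \<mu>1, its complement with respect to \<mu>2; subsets of complementary sets are
  disjoint.\<close>

lemma mutually_singular_closed_sets:
  fixes \<mu>1 \<mu>2 :: "'a::metric_space measure"
  assumes "prob_space \<mu>1" "prob_space \<mu>2" and s: "sets \<mu>1 = sets borel" "sets \<mu>2 = sets borel"
    and sing: "mutually_singular \<mu>1 \<mu>2" and "0 < e"
  obtains F1 F2 where "closed F1" "closed F2" "F1 \<inter> F2 = {}" "measure \<mu>1 (- F1) < e" "measure \<mu>2 (- F2) < e"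
proof -
  interpret m1: prob_space \<mu>1 by fact
  interpret m2: prob_space \<mu>2 by fact
  have sp: "space \<mu>1 = UNIV" "space \<mu>2 = UNIV" using s[THEN sets_eq_imp_space_eq] by simp_all
  obtain C where C: "C \<in> sets borel" "emeasure \<mu>1 C = 1" "emeasure \<mu>2 C = 0"
    using sing s by (auto simp: mutually_singular_def)
  then have C': "- C \<in> sets borel" "measure \<mu>1 (- C) = 0" "measure \<mu>2 C = 0"
    using m1.prob_compl[of C] by (auto simp: s sp Compl_eq_Diff_UNIV measure_def)
  obtain F1 where F1: "closed F1" "F1 \<subseteq> C" "measure \<mu>1 (C - F1) < e"
    using exists_closed_inner[OF m1.finite_measure_axioms s(1) C(1) \<open>0 < e\<close>] .
  obtain F2 where F2: "closed F2" "F2 \<subseteq> - C" "measure \<mu>2 (- C - F2) < e"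
    using exists_closed_inner[OF m2.finite_measure_axioms s(2) C'(1) \<open>0 < e\<close>] .
  have "measure \<mu>1 (- F1) \<le> measure \<mu>1 ((C - F1) \<union> - C)"
    using F1 C by (intro m1.finite_measure_mono) (auto simp: s)
  also have "\<dots> \<le> measure \<mu>1 (C - F1) + measure \<mu>1 (- C)"
    using F1 C by (intro measure_Un_le) (auto simp: s)
  finally have 1: "measure \<mu>1 (- F1) < e" using F1(3) C'(2) by simp
  have "measure \<mu>2 (- F2) \<le> measure \<mu>2 ((- C - F2) \<union> C)"
    using F2 C by (intro m2.finite_measure_mono) (auto simp: s)
  also have "\<dots> \<le> measure \<mu>2 (- C - F2) + measure \<mu>2 C"
    using F2 C by (intro measure_Un_le) (auto simp: s)
  finally have 2: "measure \<mu>2 (- F2) < e" using F2(3) C'(3) by simp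
  show thesis using that[OF F1(1) F2(1) _ 1 2] F1(2) F2(2) by auto
qed

text \<open>Disjoint closed sets may have distance 0. But each point of G has positive distance to
  F, so the parts of G at distance at least 1 / (n + 1) from F increase to G, and one of them misses
  less than e of its mass.\<close>

lemma exists_separated_closed_subset:
  fixes F G :: "'a::metric_space set"
  assumes "finite_measure M" and M: "sets M = sets borel" and F: "closed F" "closed G" "F \<inter> G = {}" and "0 < e"
  obtains H \<eta> where "closed H" "H \<subseteq> G" "measure M (G - H) < e" "0 < \<eta>" "\<And>a b. a \<in> F \<Longrightarrow> b \<in> H \<Longrightarrow> \<eta> \<le> dist a b"
proof (cases "F = {}")
  case True
  \<comment> \<open>\<open>infdist\<close> to the empty set is 0, so this case is separate; the
    bound is vacuous and 1 serves as \<eta>.\<close>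
  show thesis by (rule that[of G 1]) (use F True \<open>0 < e\<close> in auto)
next
  case False
  interpret finite_measure M by fact
  define H where "H n = {y\<in>G. 1 / real (Suc n) \<le> infdist y F}" for n
  have H: "closed (H n)" for n
  proof -
    have "H n = G \<inter> {y. 1 / real (Suc n) \<le> infdist y F}" by (auto simp: H_def)
    moreover have "closed {y. 1 / real (Suc n) \<le> infdist y F}"
      by (intro closed_Collect_le continuous_intros)
    ultimately show ?thesis using F by (simp add: closed_Int)
  qed
  have "incseq H"
  proof (intro incseq_SucI subsetI)
    fix n y assume "y \<in> H n"
    moreover have "1 / real (Suc (Suc n)) \<le> 1 / real (Suc n)" by (simp add: frac_le)
    ultimately show "y \<in> H (Suc n)" unfolding H_def by (auto intro: order_trans simp del: of_nat_Suc)
  qed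
  have "(\<Union>n. H n) = G"
  proof (intro equalityI subsetI)
    fix y assume "y \<in> G"
    then have "0 < infdist y F"
      using F False in_closed_iff_infdist_zero[of F y] infdist_nonneg[of y F] by force
    then obtain n where "1 / real (Suc n) < infdist y F" by (rule nat_approx_posE)
    with \<open>y \<in> G\<close> show "y \<in> (\<Union>n. H n)" by (auto simp: H_def intro: less_imp_le)
  qed (auto simp: H_def)
  moreover have "(\<lambda>n. measure M (H n)) \<longlonglongrightarrow> measure M (\<Union>n. H n)"
    using H \<open>incseq H\<close> by (intro finite_Lim_measure_incseq) (auto simp: M)
  ultimately have "\<forall>\<^sub>F n in sequentially. measure M G - e < measure M (H n)"
    using \<open>0 < e\<close> by (intro order_tendstoD(1)) auto
  then obtain n where n: "measure M G - e < measure M (H n)"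
    by (metis eventually_happens sequentially_bot)
  have HG: "H n \<subseteq> G" by (auto simp: H_def)
  have "measure M (G - H n) = measure M G - measure M (H n)"
    using H F HG by (intro finite_measure_Diff) (auto simp: M)
  with n have "measure M (G - H n) < e" by simp
  moreover have "1 / real (Suc n) \<le> dist a b" if "a \<in> F" "b \<in> H n" for a b
    using infdist_le[OF \<open>a \<in> F\<close>, of b] that by (simp add: H_def dist_commute)
  ultimately show thesis using that[of "H n" "1 / real (Suc n)"] H[of n] HG by simp
qed

section \<open>Non-singularity for \<open>dist\<close> and for lower semicontinuous \<rho>\<close>

theorem theorem3p1:
  fixes P :: "'a::metric_space \<Rightarrow> 'a measure" and \<mu>1 \<mu>2 :: "'a measure"
  assumes "markov_kernel borel P"
    and "invariant_prob borel P \<mu>1"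
    and "invariant_prob borel P \<mu>2"
  shows "(coupling_condition dist P \<mu>1 \<mu>2 \<longrightarrow> \<not> mutually_singular \<mu>1 \<mu>2) \<and>
    (\<forall>\<rho> :: 'a \<Rightarrow> 'a \<Rightarrow> real.
       separable_space (euclidean :: 'a topology) \<and>
       completely_metrizable_space (euclidean :: 'a topology) \<and>
       (\<forall>x y. 0 \<le> \<rho> x y) \<and>
       lower_semicontinuous (\<lambda>(x, y). \<rho> x y) \<and>
       (\<forall>x y. \<rho> x y = 0 \<longleftrightarrow> x = y) \<and>
       coupling_condition \<rho> P \<mu>1 \<mu>2
       \<longrightarrow> \<not> mutually_singular \<mu>1 \<mu>2)"
proof (rule conjI)
  have p: "prob_space \<mu>1" "prob_space \<mu>2" and s: "sets \<mu>1 = sets borel" "sets \<mu>2 = sets borel"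
    using assms(2,3) by (simp_all add: invariant_prob_def)
  interpret m1: prob_space \<mu>1 by fact
  interpret m2: prob_space \<mu>2 by fact
  note fin = m1.finite_measure_axioms m2.finite_measure_axioms
  \<comment> \<open>Adds up two losses of e / 2: from the whole space to A, and from A to B.\<close>
  have shrink: "measure \<mu> (- B) < e"
    if "finite_measure \<mu>" "sets \<mu> = sets borel" "A \<in> sets borel" "B \<in> sets borel"
      "measure \<mu> (- A) < e / 2" "measure \<mu> (A - B) < e / 2"
    for \<mu> :: "'a measure" and A B e
  proof -
    interpret finite_measure \<mu> by fact
    have "measure \<mu> (- B) \<le> measure \<mu> (- A \<union> (A - B))"
      using that by (intro finite_measure_mono) auto
    also have "\<dots> \<le> measure \<mu> (- A) + measure \<mu> (A - B)"
      using that by (intro measure_Un_le) auto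
    finally show ?thesis using that by simp
  qed
  show "coupling_condition dist P \<mu>1 \<mu>2 \<longrightarrow> \<not> mutually_singular \<mu>1 \<mu>2"
  proof (intro impI notI)
    assume cc: "coupling_condition dist P \<mu>1 \<mu>2" and sing: "mutually_singular \<mu>1 \<mu>2"
    have "\<exists>F1\<in>sets borel. \<exists>F2\<in>sets borel. \<exists>\<eta>>0.
        measure \<mu>1 (- F1) \<le> e \<and> measure \<mu>2 (- F2) \<le> e \<and> (\<forall>a\<in>F1. \<forall>b\<in>F2. \<eta> \<le> dist a b)"
      if "0 < e" for e
    proof -
      have e2: "0 < e / 2" using that by simp
      obtain F1 F2 where F: "closed F1" "closed F2" "F1 \<inter> F2 = {}"
          "measure \<mu>1 (- F1) < e / 2" "measure \<mu>2 (- F2) < e / 2"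
        using mutually_singular_closed_sets[OF p s sing e2] .
      \<comment> \<open>Cutting down one of the two closed sets is enough to make their distance
        positive.\<close>
      obtain H \<eta> where H: "closed H" "H \<subseteq> F2" "measure \<mu>2 (F2 - H) < e / 2" "0 < \<eta>"
          "\<And>a b. a \<in> F1 \<Longrightarrow> b \<in> H \<Longrightarrow> \<eta> \<le> dist a b"
        using exists_separated_closed_subset[OF fin(2) s(2) F(1-3) e2] by metis
      have "measure \<mu>2 (- H) < e"
        by (rule shrink[OF fin(2) s(2) _ _ F(5) H(3)]) (use F H in auto)
      then show ?thesis
        using F H that by (intro bexI[of _ F1] bexI[of _ H] exI[of _ \<eta>]) auto
    qed
    from not_coupling_condition[OF assms this] cc show False by blast
  qed
  show "\<forall>\<rho> :: 'a \<Rightarrow> 'a \<Rightarrow> real.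
       separable_space (euclidean :: 'a topology) \<and>
       completely_metrizable_space (euclidean :: 'a topology) \<and>
       (\<forall>x y. 0 \<le> \<rho> x y) \<and>
       lower_semicontinuous (\<lambda>(x, y). \<rho> x y) \<and>
       (\<forall>x y. \<rho> x y = 0 \<longleftrightarrow> x = y) \<and>
       coupling_condition \<rho> P \<mu>1 \<mu>2
       \<longrightarrow> \<not> mutually_singular \<mu>1 \<mu>2"
  proof (intro allI impI notI, elim conjE)
    fix \<rho> :: "'a \<Rightarrow> 'a \<Rightarrow> real"
    assume polish: "separable_space (euclidean :: 'a topology)" "completely_metrizable_space (euclidean :: 'a topology)"
      and nn: "\<forall>x y. 0 \<le> \<rho> x y" and lsc: "lower_semicontinuous (\<lambda>(x, y). \<rho> x y)"
      and pd: "\<forall>x y. \<rho> x y = 0 \<longleftrightarrow> x = y"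
      and cc: "coupling_condition \<rho> P \<mu>1 \<mu>2" and sing: "mutually_singular \<mu>1 \<mu>2"
    have "\<exists>F1\<in>sets borel. \<exists>F2\<in>sets borel. \<exists>\<eta>>0.
        measure \<mu>1 (- F1) \<le> e \<and> measure \<mu>2 (- F2) \<le> e \<and> (\<forall>a\<in>F1. \<forall>b\<in>F2. \<eta> \<le> \<rho> a b)"
      if "0 < e" for e
    proof -
      have e2: "0 < e / 2" using that by simp
      obtain F1 F2 where F: "closed F1" "closed F2" "F1 \<inter> F2 = {}"
          "measure \<mu>1 (- F1) < e / 2" "measure \<mu>2 (- F2) < e / 2"
        using mutually_singular_closed_sets[OF p s sing e2] .
      \<comment> \<open>Off the diagonal \<rho> is positive, but on disjoint closed sets it may come
        arbitrarily close to 0; on a product of compact sets lower semicontinuity rules this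
        out.\<close>
      obtain K1 where K1: "compact K1" "measure \<mu>1 (- K1) < e / 2"
        using exists_compact_inner[OF fin(1) s(1) polish e2] .
      obtain K2 where K2: "compact K2" "measure \<mu>2 (- K2) < e / 2"
        using exists_compact_inner[OF fin(2) s(2) polish e2] .
      have K: "compact (F1 \<inter> K1)" "compact (F2 \<inter> K2)"
        using F K1 K2 by (simp_all add: closed_Int_compact)
      have "0 < (\<lambda>(x, y). \<rho> x y) z" if "z \<in> (F1 \<inter> K1) \<times> (F2 \<inter> K2)" for z
      proof -
        have "fst z \<noteq> snd z" using that F(3) by auto
        then have "\<rho> (fst z) (snd z) \<noteq> 0" using pd by blast
        moreover have "0 \<le> \<rho> (fst z) (snd z)" using nn by blast
        ultimately show ?thesis by (simp add: split_beta)
      qed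
      then obtain \<eta> where \<eta>: "0 < \<eta>" "\<And>z. z \<in> (F1 \<inter> K1) \<times> (F2 \<inter> K2) \<Longrightarrow> \<eta> \<le> (\<lambda>(x, y). \<rho> x y) z"
        using lower_semicontinuous_pos_bounded_below[OF lsc compact_Times[OF K]] by metis
      have B: "F1 \<in> sets borel" "F2 \<in> sets borel" "F1 \<inter> K1 \<in> sets borel" "F2 \<inter> K2 \<in> sets borel"
        using F K by (simp_all add: borel_closed compact_imp_closed)
      have "measure \<mu>1 (F1 - F1 \<inter> K1) \<le> measure \<mu>1 (- K1)"
        using B K1 by (intro m1.finite_measure_mono) (auto simp: s borel_closed compact_imp_closed)
      then have 1: "measure \<mu>1 (- (F1 \<inter> K1)) < e"
        using F K1 by (intro shrink[OF fin(1) s(1) B(1,3)]) simp_all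
      have "measure \<mu>2 (F2 - F2 \<inter> K2) \<le> measure \<mu>2 (- K2)"
        using B K2 by (intro m2.finite_measure_mono) (auto simp: s borel_closed compact_imp_closed)
      then have 2: "measure \<mu>2 (- (F2 \<inter> K2)) < e"
        using F K2 by (intro shrink[OF fin(2) s(2) B(2,4)]) simp_all
      show ?thesis
        using 1 2 B(3,4) \<eta>
        by (intro bexI[of _ "F1 \<inter> K1"] bexI[of _ "F2 \<inter> K2"] exI[of _ \<eta>]) (auto simp: less_imp_le)
    qed
    from not_coupling_condition[OF assms this] cc show False by blast
  qed
qed

end
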